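(* Fix $k \geq 2$ and let $\alpha,\beta$ be computable reals in $[0,1]$. The following are equivalent: (a) $(\alpha,\beta) \in \mathsf{EXT}(k)$; (b) there are a constant $d$ and a computable function $f:\mathbb{N}\to\mathbb{N}$ with $f(n) \geq (\beta/\alpha)n - O(1)$ such that for all $n$ there is a $k$-hypergraph $G_n$ with $2^n$ vertices and $2^{f(n)}$ hyperedges with the property that every set $U$ of vertices of $G_n$ with $|U| \leq 2^{\beta n - d}$ satisfies $e(U) < 2^{\alpha f(n) + d}$; (c) there are a constant $d$ and a computable function $f:\mathbb{N}\to\mathbb{N}$ with $f(n) \geq (\beta/\alpha)n - O(1)$ such that for all $n$ there is a $k$-hypergraph $G_n$ with $2^n$ vertices and $2^{f(n)}$ hyperedges with the property that every set $U$ of vertices of $G_n$ with $|U| \leq 2^{\beta n}$ satisfies $e(U) < 2^{\alpha f(n) + d}$.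
   Context: $C$ denotes plain Kolmogorov complexity: $C(\sigma)=\min\{|p|:\mathbb{U}(p)=\sigma\}$ for a fixed optimal machine $\mathbb{U}$. For $k\ge1$, $\mathsf{EXT}(k)$ is the set of pairs $(\alpha,\beta)\in[0,1]^2$ for which there exist a total one-to-one computable $f:\mathbb{N}\to\mathbb{N}$, total computable $\Gamma_1,\ldots,\Gamma_k:\{0,1\}^*\to\{0,1\}^*$ and $d\in\mathbb{N}$ such that for all $n$ and every $\sigma$ with $|\sigma|=f(n)$: $|\Gamma_i(\sigma)|=n$ for all $i$, and if $C(\sigma)\ge\alpha|\sigma|+d$ then $C(\Gamma_i(\sigma))\ge\beta|\Gamma_i(\sigma)|-d$ for some $i$. "$f(n)\ge(\beta/\alpha)n-O(1)$" means there is a constant $c$ with $f(n)\ge(\beta/\alpha)n-c$ for all $n$. A $k$-hypergraph $G=(V,E)$ consists of a finite vertex set $V$ and a finite set $E$ of hyperedges, each hyperedge $e$ associated to a set $i(e)$ of exactly $k$ distinct vertices (distinct hyperedges may have the same associated set). For $U\subseteq V$, $e(U)$ is the number of hyperedges $e$ with $i(e)\subseteq U$.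
   Formalization: In (b) and (c), "for all n" is read as "for all n with 2^n ≥ k", since no k-hypergraph with fewer than k vertices has a hyperedge (so n=0 is impossible); for α=0 the ratio β/α is read as ∞ if β>0 and as 0 if β=0. *)

theory Defs
  imports Complex_Main "HOL-Library.Nat_Bijection" "HOL-Library.Extended_Real"
begin

text \<open>
  Partial recursive functions in unary form: the pairing bijection \<^const>\<open>prod_encode\<close> replaces
  functions of several arguments.  The clauses \<open>prec\<close> and \<open>search\<close> are primitive recursion and
  unbounded search with a parameter \<open>a\<close>.
\<close>

definition mu_search :: "(nat \<Rightarrow> nat option) \<Rightarrow> nat \<Rightarrow> nat option" where
  "mu_search f a =
    (let hit = (\<lambda>m. f (prod_encode (a, m)) = Some 0 \<and>
                    (\<forall>j<m. \<exists>v. f (prod_encode (a, j)) = Some v \<and> v \<noteq> 0))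
     in if \<exists>m. hit m then Some (LEAST m. hit m) else None)"

inductive partial_recursive :: "(nat \<Rightarrow> nat option) \<Rightarrow> bool" where
  zero: "partial_recursive (\<lambda>_. Some 0)"
| succ: "partial_recursive (\<lambda>n. Some (Suc n))"
| left: "partial_recursive (\<lambda>n. Some (fst (prod_decode n)))"
| right: "partial_recursive (\<lambda>n. Some (snd (prod_decode n)))"
| pair: "partial_recursive f \<Longrightarrow> partial_recursive g \<Longrightarrow>
    partial_recursive (\<lambda>n. Option.bind (f n) (\<lambda>x. Option.bind (g n) (\<lambda>y. Some (prod_encode (x, y)))))"
| comp: "partial_recursive f \<Longrightarrow> partial_recursive g \<Longrightarrow>
    partial_recursive (\<lambda>n. Option.bind (g n) f)"
| prec: "partial_recursive f \<Longrightarrow> partial_recursive g \<Longrightarrow>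
    partial_recursive (\<lambda>n. case prod_decode n of (a, m) \<Rightarrow>
      rec_nat (f a) (\<lambda>y r. Option.bind r (\<lambda>v. g (prod_encode (a, prod_encode (y, v))))) m)"
| search: "partial_recursive f \<Longrightarrow> partial_recursive (mu_search f)"

definition computable_nat :: "(nat \<Rightarrow> nat) \<Rightarrow> bool" where
  "computable_nat f \<longleftrightarrow> partial_recursive (\<lambda>n. Some (f n))"

text \<open>Bijective base-2 numbering of the binary strings.\<close>

primrec str_code :: "bool list \<Rightarrow> nat" where
  "str_code [] = 0"
| "str_code (b # bs) = 2 * str_code bs + (if b then 2 else 1)"

definition partial_computable_str :: "(bool list \<Rightarrow> bool list option) \<Rightarrow> bool" where
  "partial_computable_str M \<longleftrightarrow>
    (\<exists>g. partial_recursive g \<and> (\<forall>p. g (str_code p) = map_option str_code (M p)))"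

definition computable_str :: "(bool list \<Rightarrow> bool list) \<Rightarrow> bool" where
  "computable_str \<Gamma> \<longleftrightarrow> partial_computable_str (\<lambda>p. Some (\<Gamma> p))"

definition computable_real :: "real \<Rightarrow> bool" where
  "computable_real x \<longleftrightarrow>
    (\<exists>a b c. computable_nat a \<and> computable_nat b \<and> computable_nat c \<and>
      (\<forall>n. c n > 0 \<and> \<bar>x - (real (a n) - real (b n)) / real (c n)\<bar> \<le> 1 / 2 ^ n))"

definition optimal_machine :: "(bool list \<Rightarrow> bool list option) \<Rightarrow> bool" where
  "optimal_machine U \<longleftrightarrow> partial_computable_str U \<and>
    (\<forall>M. partial_computable_str M \<longrightarrow>
      (\<exists>c. \<forall>p \<sigma>. M p = Some \<sigma> \<longrightarrow> (\<exists>q. U q = Some \<sigma> \<and> length q \<le> length p + c)))"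

text \<open>The minimum is over a nonempty set for every \<open>\<sigma>\<close> when \<open>U\<close> is optimal.\<close>

definition plain_complexity :: "(bool list \<Rightarrow> bool list option) \<Rightarrow> bool list \<Rightarrow> nat" where
  "plain_complexity U \<sigma> = (LEAST l. \<exists>p. length p = l \<and> U p = Some \<sigma>)"

definition EXT :: "(bool list \<Rightarrow> bool list option) \<Rightarrow> nat \<Rightarrow> (real \<times> real) set" where
  "EXT U k = {(\<alpha>, \<beta>). \<alpha> \<in> {0..1} \<and> \<beta> \<in> {0..1} \<and>
    (\<exists>(f :: nat \<Rightarrow> nat) (\<Gamma> :: nat \<Rightarrow> bool list \<Rightarrow> bool list) (d :: nat).
      computable_nat f \<and> inj f \<and> (\<forall>i\<in>{1..k}. computable_str (\<Gamma> i)) \<and>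
      (\<forall>n \<sigma>. length \<sigma> = f n \<longrightarrow>
        (\<forall>i\<in>{1..k}. length (\<Gamma> i \<sigma>) = n) \<and>
        (real (plain_complexity U \<sigma>) \<ge> \<alpha> * real (length \<sigma>) + real d \<longrightarrow>
          (\<exists>i\<in>{1..k}. real (plain_complexity U (\<Gamma> i \<sigma>)) \<ge> \<beta> * real (length (\<Gamma> i \<sigma>)) - real d))))}"

text \<open>
  The quotient is taken in the extended reals because \<open>\<alpha>\<close> may be \<open>0\<close>: there \<open>\<beta> / 0 = \<infinity>\<close> for
  \<open>\<beta> > 0\<close> (so that no \<open>f\<close> qualifies), whereas real division would make the bound void;
  \<open>0 / 0 = 0\<close>.
\<close>

definition ratio_bound :: "real \<Rightarrow> real \<Rightarrow> (nat \<Rightarrow> nat) \<Rightarrow> bool" where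
  "ratio_bound \<alpha> \<beta> f \<longleftrightarrow>
    (\<exists>c::real. \<forall>n. ereal (real (f n)) \<ge> (ereal \<beta> / ereal \<alpha>) * ereal (real n) - ereal c)"

lemma ratio_bound_pos:
  "\<alpha> > 0 \<Longrightarrow> ratio_bound \<alpha> \<beta> f \<longleftrightarrow> (\<exists>c. \<forall>n. real (f n) \<ge> (\<beta> / \<alpha>) * real n - c)"
  by (simp add: ratio_bound_def)

lemma ratio_bound_0_0: "ratio_bound 0 0 f"
  by (auto simp: ratio_bound_def divide_ereal_def zero_ereal_def[symmetric] intro!: exI[of _ 0])

lemma not_ratio_bound_0: "\<beta> > 0 \<Longrightarrow> \<not> ratio_bound 0 \<beta> f"
  by (auto simp: ratio_bound_def divide_ereal_def intro!: exI[of _ 1])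

definition k_hypergraph :: "nat \<Rightarrow> 'v set \<Rightarrow> 'e set \<Rightarrow> ('e \<Rightarrow> 'v set) \<Rightarrow> bool" where
  "k_hypergraph k V E inc \<longleftrightarrow>
    finite V \<and> finite E \<and> (\<forall>e\<in>E. inc e \<subseteq> V \<and> card (inc e) = k)"

definition edges_within :: "'e set \<Rightarrow> ('e \<Rightarrow> 'v set) \<Rightarrow> 'v set \<Rightarrow> nat" where
  "edges_within E inc W = card {e \<in> E. inc e \<subseteq> W}"

end

theory Submission
  imports Defs "HOL-Library.FuncSet"
begin

text \<open>
  If \<open>\<beta> \<le> \<alpha>\<close>, the identity map and \<open>f n = n\<close> witness all three conditions, so let \<open>\<alpha> < \<beta>\<close>.

  From (a) to (b): the edges of \<open>G\<^sub>n\<close> are the strings \<open>\<sigma>\<close> of length \<open>f n\<close>, on the vertices \<open>\<Gamma>\<^sub>i \<sigma>\<close>.  A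
  small vertex set spanning too many edges could be found by exhaustive search, so its elements would
  have small complexity, while one of the many edges inside it is complex.  The bound on \<open>f\<close> comes from
  strings of length \<open>f n\<close> and complexity \<open>\<alpha> f n + O(1)\<close>.

  From (b) to (c): cut a set of size \<open>2 ^ (\<beta> n)\<close> into boundedly many blocks; each edge meets at most
  \<open>k\<close> of them.

  From (c) to (a): find \<open>G\<^sub>n\<close> by search and let \<open>\<Gamma>\<^sub>i \<sigma>\<close> be the \<open>i\<close>-th vertex of edge number \<open>\<sigma>\<close>.  The edges
  all of whose vertices have small complexity are few and can be enumerated, so they are simple.  This
  needs an injective \<open>f\<close>, which is obtained with \<open>f n = (\<beta> / \<alpha>) n + O(1)\<close>: if
  \<open>(1 - \<alpha>) \<beta> / \<alpha> < k (1 - \<beta>)\<close>, random hypergraphs of that size have the required property, and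
  otherwise averaging over vertex sets of size \<open>2 ^ (\<beta> n)\<close> forces the given \<open>f\<close> to be of that form.
\<close>

section \<open>Closure properties of computable functions\<close>

text \<open>Every complexity bound here tolerates only O(1) bits, so a description of
  \<open>t\<close> bits cannot also carry \<open>n\<close> or \<open>f n\<close>. These are
  recovered from \<open>t\<close> itself: it is chosen as \<beta> \<open>n\<close> or \<alpha>
  \<open>f n\<close> up to a constant, and inverting a computable approximation of that linear map
  leaves a remainder from a finite range, with one machine for each value. This is where
  computability of \<alpha> and \<beta> enters, and why \<alpha> = 0 is treated apart. The step from
  (a) to (b) looks circular: the search for a violating set must know the slack, and the slack must
  exceed the constant of the machine that searches. The way out is to make the set smaller by
  \<open>2 * e\<close> bits while paying only \<open>e\<close> bits to describe \<open>e\<close>. In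
  the step from (c) to (a) the edges to be described form only an enumerable set. Pairing each edge
  with the stage of its first appearance gives a decidable set, so one description lemma serves both
  directions.\<close>

abbreviation pfst :: "nat \<Rightarrow> nat" where "pfst z \<equiv> fst (prod_decode z)"
abbreviation psnd :: "nat \<Rightarrow> nat" where "psnd z \<equiv> snd (prod_decode z)"

definition computable2 :: "(nat \<Rightarrow> nat \<Rightarrow> nat) \<Rightarrow> bool" where
  "computable2 f \<longleftrightarrow> computable_nat (\<lambda>z. f (pfst z) (psnd z))"

definition decidable :: "(nat \<Rightarrow> bool) \<Rightarrow> bool" where
  "decidable P \<longleftrightarrow> computable_nat (\<lambda>x. of_bool (P x))"

definition decidable2 :: "(nat \<Rightarrow> nat \<Rightarrow> bool) \<Rightarrow> bool" where
  "decidable2 P \<longleftrightarrow> decidable (\<lambda>z. P (pfst z) (psnd z))"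

lemma computable_compose:
  assumes "computable_nat f" "computable_nat g"
  shows "computable_nat (\<lambda>x. f (g x))"
  using partial_recursive.comp[of "\<lambda>n. Some (f n)" "\<lambda>n. Some (g n)"] assms
  by (simp add: computable_nat_def)

lemma computable_pair:
  assumes "computable_nat f" "computable_nat g"
  shows "computable_nat (\<lambda>x. prod_encode (f x, g x))"
  using partial_recursive.pair[of "\<lambda>n. Some (f n)" "\<lambda>n. Some (g n)"] assms
  by (simp add: computable_nat_def)

lemma computable_pfst: "computable_nat f \<Longrightarrow> computable_nat (\<lambda>x. pfst (f x))"
  using computable_compose[of pfst f] partial_recursive.left by (simp add: computable_nat_def)

lemma computable_psnd: "computable_nat f \<Longrightarrow> computable_nat (\<lambda>x. psnd (f x))"
  using computable_compose[of psnd f] partial_recursive.right by (simp add: computable_nat_def)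

lemma computable_Suc: "computable_nat f \<Longrightarrow> computable_nat (\<lambda>x. Suc (f x))"
  using computable_compose[of Suc f] partial_recursive.succ by (simp add: computable_nat_def)

lemma computable_id: "computable_nat (\<lambda>x. x)"
  using computable_pair[of pfst psnd] partial_recursive.left partial_recursive.right
  by (simp add: computable_nat_def)

lemma computable_const: "computable_nat (\<lambda>x. c)"
proof (induction c)
  case 0
  show ?case using partial_recursive.zero by (simp add: computable_nat_def)
next
  case (Suc c)
  then show ?case by (rule computable_Suc)
qed

lemma computable2D:
  assumes "computable2 F" "computable_nat a" "computable_nat b"
  shows "computable_nat (\<lambda>x. F (a x) (b x))"
  using computable_compose[OF assms(1)[unfolded computable2_def] computable_pair[OF assms(2,3)]]
  by simp

lemma decidable_compose: "decidable P \<Longrightarrow> computable_nat f \<Longrightarrow> decidable (\<lambda>x. P (f x))"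
  unfolding decidable_def by (rule computable_compose[of "\<lambda>x. of_bool (P x)"])

text \<open>The step function may depend on the whole input \<open>x\<close>, so \<open>x\<close>
  itself is kept as the parameter and paired with the bound \<open>b x\<close>. On total functions
  no option value fails, and the recursion of \<open>prec\<close> collapses to
  \<open>rec_nat\<close>.\<close>

lemma computable_rec_nat:
  assumes f: "computable_nat f" and b: "computable_nat b"
    and G: "computable_nat (\<lambda>z. G (pfst z) (pfst (psnd z)) (psnd (psnd z)))"
  shows "computable_nat (\<lambda>x. rec_nat (f x) (G x) (b x))"
proof -
  let ?g = "\<lambda>z. G (pfst z) (pfst (psnd z)) (psnd (psnd z))"
  have rec: "rec_nat (Some (f a)) (\<lambda>y r. Option.bind r (\<lambda>v. Some (?g (prod_encode (a, prod_encode (y, v)))))) m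
      = Some (rec_nat (f a) (G a) m)" for a m
    by (induction m) simp_all
  have "computable_nat (\<lambda>n. rec_nat (f (pfst n)) (G (pfst n)) (psnd n))"
    using partial_recursive.prec[of "\<lambda>n. Some (f n)" "\<lambda>z. Some (?g z)"] f G
    unfolding computable_nat_def rec by (simp add: case_prod_beta)
  from computable_compose[OF this computable_pair[OF computable_id b]] show ?thesis by simp
qed

lemma computable_add:
  assumes "computable_nat f" "computable_nat g"
  shows "computable_nat (\<lambda>x. f x + g x)"
proof -
  have "rec_nat m (\<lambda>_ r. Suc r) n = m + n" for m n by (induction n) simp_all
  then show ?thesis
    using computable_rec_nat[OF assms, of "\<lambda>_ _ r. Suc r"]
    by (simp add: computable_Suc computable_psnd computable_id)
qed

lemma computable_mult:
  assumes "computable_nat f" "computable_nat g"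
  shows "computable_nat (\<lambda>x. f x * g x)"
proof -
  have "rec_nat 0 (\<lambda>_ r. r + m) n = m * n" for m n :: nat by (induction n) simp_all
  then show ?thesis
    using computable_rec_nat[OF computable_const[of 0] assms(2), of "\<lambda>x _ r. r + f x"]
    by (simp add: computable_add computable_psnd computable_pfst computable_id
        computable_compose[OF assms(1)])
qed

lemma computable_pred:
  assumes "computable_nat f"
  shows "computable_nat (\<lambda>x. f x - Suc 0)"
proof -
  have "rec_nat 0 (\<lambda>y _. y) n = n - Suc 0" for n by (induction n) simp_all
  then show ?thesis
    using computable_rec_nat[OF computable_const[of 0] assms, of "\<lambda>_ y _. y"]
    by (simp add: computable_psnd computable_pfst computable_id)
qed

lemma computable_diff:
  assumes "computable_nat f" "computable_nat g"
  shows "computable_nat (\<lambda>x. f x - g x)"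
proof -
  have "rec_nat m (\<lambda>_ r. r - Suc 0) n = m - n" for m n :: nat by (induction n) simp_all
  then show ?thesis
    using computable_rec_nat[OF assms, of "\<lambda>_ _ r. r - Suc 0"]
    by (simp add: computable_pred computable_psnd computable_id)
qed

lemma computable_power:
  assumes "computable_nat f" "computable_nat g"
  shows "computable_nat (\<lambda>x. f x ^ g x)"
proof -
  have "rec_nat (Suc 0) (\<lambda>_ r. r * m) n = m ^ n" for m n :: nat by (induction n) simp_all
  then show ?thesis
    using computable_rec_nat[OF computable_const[of "Suc 0"] assms(2), of "\<lambda>x _ r. r * f x"]
    by (simp add: computable_mult computable_psnd computable_pfst computable_id
        computable_compose[OF assms(1)])
qed

lemma decidable_not:
  assumes "decidable P"
  shows "decidable (\<lambda>x. \<not> P x)"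
proof -
  have "of_bool (\<not> P x) = 1 - (of_bool (P x) :: nat)" for x by simp
  then show ?thesis
    using assms unfolding decidable_def by (simp only: computable_diff computable_const)
qed

lemma decidable_conj: "decidable P \<Longrightarrow> decidable Q \<Longrightarrow> decidable (\<lambda>x. P x \<and> Q x)"
  using computable_mult[of "\<lambda>x. of_bool (P x)" "\<lambda>x. of_bool (Q x)"]
  by (simp add: decidable_def of_bool_conj)

lemma decidable_disj: "decidable P \<Longrightarrow> decidable Q \<Longrightarrow> decidable (\<lambda>x. P x \<or> Q x)"
  using decidable_not[OF decidable_conj[OF decidable_not decidable_not], of P Q] by simp

lemma decidable_imp: "decidable P \<Longrightarrow> decidable Q \<Longrightarrow> decidable (\<lambda>x. P x \<longrightarrow> Q x)"
  unfolding imp_conv_disj by (intro decidable_disj decidable_not)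

lemma decidable_le:
  assumes "computable_nat f" "computable_nat g"
  shows "decidable (\<lambda>x. f x \<le> g x)"
proof -
  have "of_bool (f x \<le> g x) = 1 - (f x - g x)" for x by simp
  then show ?thesis
    using assms by (simp add: decidable_def computable_diff computable_const)
qed

lemma decidable_less:
  assumes "computable_nat f" "computable_nat g"
  shows "decidable (\<lambda>x. f x < g x)"
  using decidable_not[OF decidable_le[OF assms(2,1)]] by (simp add: not_le)

lemma decidable_eq:
  assumes "computable_nat f" "computable_nat g"
  shows "decidable (\<lambda>x. f x = g x)"
  using decidable_conj[OF decidable_le[OF assms] decidable_le[OF assms(2,1)]]
  by (simp add: eq_iff)

lemma computable_if:
  assumes "decidable P" "computable_nat f" "computable_nat g"
  shows "computable_nat (\<lambda>x. if P x then f x else g x)"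
proof -
  have "(if P x then f x else g x) = of_bool (P x) * f x + of_bool (\<not> P x) * g x" for x by simp
  then show ?thesis
    using assms decidable_not[OF assms(1)]
    by (simp only: decidable_def computable_add computable_mult)
qed

lemma computable_sum:
  assumes b: "computable_nat b" and F: "computable2 F"
  shows "computable_nat (\<lambda>x. \<Sum>i<b x. F x i)"
proof -
  have "rec_nat 0 (\<lambda>y r. r + F x y) n = (\<Sum>i<n. F x i)" for x n by (induction n) simp_all
  then show ?thesis
    using computable_rec_nat[OF computable_const[of 0] b, of "\<lambda>x y r. r + F x y"]
    by (simp add: computable_add computable_psnd computable_pfst computable_id computable2D[OF F])
qed

lemma computable_card:
  assumes b: "computable_nat b" and P: "decidable2 P"
  shows "computable_nat (\<lambda>x. card {i. i < b x \<and> P x i})"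
proof -
  have "(\<Sum>i<n. of_bool (P x i)) = card {i. i < n \<and> P x i}" for x n
  proof -
    have "{i. i < n \<and> P x i} = {..<n} \<inter> {i. P x i}" by auto
    then show ?thesis by simp
  qed
  then show ?thesis
    using computable_sum[OF b, of "\<lambda>x i. of_bool (P x i)"] P
    by (simp add: decidable2_def decidable_def computable2_def)
qed

lemma decidable_ex_less:
  assumes b: "computable_nat b" and P: "decidable2 P"
  shows "decidable (\<lambda>x. \<exists>i<b x. P x i)"
proof -
  have "(\<exists>i<b x. P x i) \<longleftrightarrow> 0 < card {i. i < b x \<and> P x i}" for x
    by (subst card_gt_0_iff) auto
  then show ?thesis
    using decidable_less[OF computable_const[of 0] computable_card[OF assms]] by simp
qed

lemma decidable_all_less:
  assumes b: "computable_nat b" and P: "decidable2 P"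
  shows "decidable (\<lambda>x. \<forall>i<b x. P x i)"
proof -
  have "decidable2 (\<lambda>x i. \<not> P x i)" using P by (simp add: decidable2_def decidable_not)
  from decidable_not[OF decidable_ex_less[OF b this]] show ?thesis by simp
qed

lemma decidable_ball_finite:
  assumes "finite I" "\<And>i. i \<in> I \<Longrightarrow> decidable (P i)"
  shows "decidable (\<lambda>x. \<forall>i\<in>I. P i x)"
  using assms
proof (induction I rule: finite_induct)
  case empty
  then show ?case by (simp add: decidable_def computable_const)
next
  case (insert i I)
  then show ?case using decidable_conj[of "P i" "\<lambda>x. \<forall>i\<in>I. P i x"] by simp
qed

lemma partial_recursive_Least:
  assumes P: "decidable2 P"
  shows "partial_recursive (\<lambda>x. if \<exists>m. P x m then Some (LEAST m. P x m) else None)"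
proof -
  \<comment> \<open>\<open>mu_search\<close> stops at the value \<open>0\<close>, hence the negated
    indicator.\<close>
  let ?f = "\<lambda>z. Some (of_bool (\<not> P (pfst z) (psnd z)) :: nat)"
  have "partial_recursive ?f"
    using P decidable_not[of "\<lambda>z. P (pfst z) (psnd z)"]
    by (simp add: decidable2_def decidable_def computable_nat_def)
  then have "partial_recursive (mu_search ?f)" by (rule partial_recursive.search)
  moreover have "mu_search ?f = (\<lambda>x. if \<exists>m. P x m then Some (LEAST m. P x m) else None)"
  proof
    fix x
    have hit: "(P x m \<and> (\<forall>j<m. \<not> P x j)) \<longleftrightarrow> (\<exists>m. P x m) \<and> m = (LEAST m. P x m)" for m
      by (metis LeastI_ex linorder_less_linear not_less_Least)
    show "mu_search ?f x = (if \<exists>m. P x m then Some (LEAST m. P x m) else None)"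
      unfolding mu_search_def Let_def
      by (simp add: hit Least_equality)
  qed
  ultimately show ?thesis by simp
qed

lemma computable_Least:
  assumes "\<And>x. \<exists>m. P x m" "decidable2 P"
  shows "computable_nat (\<lambda>x. LEAST m. P x m)"
  using partial_recursive_Least[OF assms(2)] assms(1) by (simp add: computable_nat_def)

lemma computable_div:
  assumes f: "computable_nat f" and g: "computable_nat g"
  shows "computable_nat (\<lambda>x. f x div g x)"
proof -
  \<comment> \<open>The disjunct \<open>g x = 0\<close> stops the search at \<open>0\<close>, the
    default value of division by zero.\<close>
  have "f x div g x = (LEAST q. g x = 0 \<or> f x < Suc q * g x)" for x
  proof (rule Least_equality[symmetric])
    show "g x = 0 \<or> f x < Suc (f x div g x) * g x"
      using dividend_less_div_times[of "g x" "f x"] by auto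
  next
    fix q assume "g x = 0 \<or> f x < Suc q * g x"
    then show "f x div g x \<le> q"
      by (metis div_by_0 less_mult_imp_div_less less_Suc_eq_le zero_le)
  qed
  moreover have "\<exists>q. g x = 0 \<or> f x < Suc q * g x" for x
    by (intro exI[of _ "f x"]) (cases "g x"; simp)
  moreover have "decidable2 (\<lambda>x q. g x = 0 \<or> f x < Suc q * g x)"
    unfolding decidable2_def
    by (intro decidable_disj decidable_eq decidable_less computable_mult computable_Suc
        computable_compose[OF f] computable_compose[OF g] computable_const
        computable_pfst computable_psnd computable_id)
  ultimately show ?thesis using computable_Least[of "\<lambda>x q. g x = 0 \<or> f x < Suc q * g x"] by simp
qed

lemma computable_mod:
  assumes f: "computable_nat f" and g: "computable_nat g"
  shows "computable_nat (\<lambda>x. f x mod g x)"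
  by (subst minus_div_mult_eq_mod[symmetric])
    (intro computable_diff computable_mult computable_div assms)

lemma decidable_set_decode:
  assumes f: "computable_nat f" and g: "computable_nat g"
  shows "decidable (\<lambda>x. f x \<in> set_decode (g x))"
proof -
  have "f x \<in> set_decode (g x) \<longleftrightarrow> (g x div 2 ^ f x) mod 2 = 1" for x
    by (simp add: set_decode_def odd_iff_mod_2_eq_one)
  then show ?thesis
    using assms by (simp add: decidable_eq computable_mod computable_div computable_power computable_const)
qed

lemma computable2I: "computable_nat (\<lambda>z. F (pfst z) (psnd z)) \<Longrightarrow> computable2 F"
  by (simp add: computable2_def)

lemma decidable2I: "decidable (\<lambda>z. P (pfst z) (psnd z)) \<Longrightarrow> decidable2 P"
  by (simp add: decidable2_def)

lemmas computable_rules =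
  computable_id computable_const computable_Suc computable_pfst computable_psnd computable_pair
  computable_add computable_mult computable_diff computable_power computable_div computable_mod
  computable_if computable_sum computable_card decidable_not decidable_conj decidable_disj
  decidable_imp decidable_le decidable_less decidable_eq decidable_ex_less decidable_all_less
  decidable_set_decode computable2I decidable2I

section \<open>Step-bounded computation\<close>

definition computable3 :: "(nat \<Rightarrow> nat \<Rightarrow> nat \<Rightarrow> nat) \<Rightarrow> bool" where
  "computable3 f \<longleftrightarrow> computable_nat (\<lambda>x. f (pfst x) (pfst (psnd x)) (psnd (psnd x)))"

definition decidable3 :: "(nat \<Rightarrow> nat \<Rightarrow> nat \<Rightarrow> bool) \<Rightarrow> bool" where
  "decidable3 P \<longleftrightarrow> decidable (\<lambda>x. P (pfst x) (pfst (psnd x)) (psnd (psnd x)))"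

lemma computable3D:
  assumes "computable3 F" "computable_nat a" "computable_nat b" "computable_nat c"
  shows "computable_nat (\<lambda>x. F (a x) (b x) (c x))"
  using computable_compose[OF assms(1)[unfolded computable3_def]
      computable_pair[OF assms(2) computable_pair[OF assms(3,4)]]]
  by simp

lemma decidable3D:
  assumes "decidable3 P" "computable_nat a" "computable_nat b" "computable_nat c"
  shows "decidable (\<lambda>x. P (a x) (b x) (c x))"
  using decidable_compose[OF assms(1)[unfolded decidable3_def]
      computable_pair[OF assms(2) computable_pair[OF assms(3,4)]]]
  by simp

text \<open>\<open>T x s\<close> is \<open>Suc y\<close> if \<open>g x\<close> is seen to equal \<open>y\<close> within \<open>s\<close> steps, and \<open>0\<close> otherwise.\<close>

definition step_bounded :: "(nat \<Rightarrow> nat option) \<Rightarrow> (nat \<Rightarrow> nat \<Rightarrow> nat) \<Rightarrow> bool" where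
  "step_bounded g T \<longleftrightarrow> computable2 T \<and>
    (\<forall>x s s' y. T x s = Suc y \<longrightarrow> s \<le> s' \<longrightarrow> T x s' = Suc y) \<and>
    (\<forall>x y. g x = Some y \<longleftrightarrow> (\<exists>s. T x s = Suc y))"

lemma step_boundedD:
  assumes "step_bounded g T"
  shows "computable2 T"
    and "T x s = Suc y \<Longrightarrow> s \<le> s' \<Longrightarrow> T x s' = Suc y"
    and "g x = Some y \<longleftrightarrow> (\<exists>s. T x s = Suc y)"
  using assms unfolding step_bounded_def by blast+

lemma step_bounded_total:
  assumes "computable_nat f"
  shows "step_bounded (\<lambda>x. Some (f x)) (\<lambda>x s. Suc (f x))"
  unfolding step_bounded_def computable2_def
  by (auto intro!: computable_rules computable_compose[OF assms])

lemma step_bounded_pair: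
  assumes f: "step_bounded f F" and g: "step_bounded g G"
  shows "step_bounded (\<lambda>n. Option.bind (f n) (\<lambda>x. Option.bind (g n) (\<lambda>y. Some (prod_encode (x, y)))))
    (\<lambda>x s. if F x s = 0 \<or> G x s = 0 then 0 else Suc (prod_encode (F x s - 1, G x s - 1)))"
    (is "step_bounded ?h ?H")
  unfolding step_bounded_def
proof (intro conjI allI impI)
  show "computable2 ?H"
    by (intro computable_rules computable2D[OF step_boundedD(1)[OF f]] computable2D[OF step_boundedD(1)[OF g]])
next
  fix x s s' y assume H: "?H x s = Suc y" "s \<le> s'"
  then obtain a b where ab: "F x s = Suc a" "G x s = Suc b"
    by (auto simp: gr0_conv_Suc split: if_splits)
  then have "F x s' = Suc a" "G x s' = Suc b"
    using step_boundedD(2)[OF f _ H(2)] step_boundedD(2)[OF g _ H(2)] by blast+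
  then show "?H x s' = Suc y" using H ab by simp
next
  fix x y
  show "?h x = Some y \<longleftrightarrow> (\<exists>s. ?H x s = Suc y)"
  proof
    assume "?h x = Some y"
    then obtain a b where ab: "f x = Some a" "g x = Some b" "y = prod_encode (a, b)"
      by (auto simp: Option.bind_eq_Some_conv)
    then obtain s s' where "F x s = Suc a" "G x s' = Suc b"
      using step_boundedD(3)[OF f] step_boundedD(3)[OF g] by blast
    then have "F x (max s s') = Suc a" "G x (max s s') = Suc b"
      using step_boundedD(2)[OF f, of x s _ "max s s'"] step_boundedD(2)[OF g, of x s' _ "max s s'"]
      by auto
    then show "\<exists>s. ?H x s = Suc y" using ab by (intro exI[of _ "max s s'"]) auto
  next
    assume "\<exists>s. ?H x s = Suc y"
    then obtain s a b where "F x s = Suc a" "G x s = Suc b" "y = prod_encode (a, b)"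
      by (auto simp: gr0_conv_Suc split: if_splits)
    then have "f x = Some a" "g x = Some b"
      using step_boundedD(3)[OF f] step_boundedD(3)[OF g] by blast+
    then show "?h x = Some y" using \<open>y = _\<close> by simp
  qed
qed

lemma step_bounded_comp:
  assumes f: "step_bounded f F" and g: "step_bounded g G"
  shows "step_bounded (\<lambda>n. Option.bind (g n) f) (\<lambda>x s. if G x s = 0 then 0 else F (G x s - 1) s)"
    (is "step_bounded ?h ?H")
  unfolding step_bounded_def
proof (intro conjI allI impI)
  show "computable2 ?H"
    by (intro computable_rules computable2D[OF step_boundedD(1)[OF f]] computable2D[OF step_boundedD(1)[OF g]])
next
  fix x s s' y assume H: "?H x s = Suc y" "s \<le> s'"
  then obtain b where "G x s = Suc b" "F b s = Suc y"
    by (auto simp: gr0_conv_Suc split: if_splits)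
  then have "G x s' = Suc b" "F b s' = Suc y"
    using step_boundedD(2)[OF f _ H(2)] step_boundedD(2)[OF g _ H(2)] by blast+
  then show "?H x s' = Suc y" by simp
next
  fix x y
  show "?h x = Some y \<longleftrightarrow> (\<exists>s. ?H x s = Suc y)"
  proof
    assume "?h x = Some y"
    then obtain b where ab: "f b = Some y" "g x = Some b"
      by (auto simp: Option.bind_eq_Some_conv)
    then obtain s s' where "F b s = Suc y" "G x s' = Suc b"
      using step_boundedD(3)[OF f] step_boundedD(3)[OF g] by blast
    then have "F b (max s s') = Suc y" "G x (max s s') = Suc b"
      using step_boundedD(2)[OF f, of b s _ "max s s'"] step_boundedD(2)[OF g, of x s' _ "max s s'"]
      by auto
    then show "\<exists>s. ?H x s = Suc y" by (intro exI[of _ "max s s'"]) auto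
  next
    assume "\<exists>s. ?H x s = Suc y"
    then obtain s b where "G x s = Suc b" "F b s = Suc y"
      by (auto simp: gr0_conv_Suc split: if_splits)
    then have "g x = Some b" "f b = Some y"
      using step_boundedD(3)[OF f] step_boundedD(3)[OF g] by blast+
    then show "?h x = Some y" by simp
  qed
qed

lemma step_bounded_prec:
  assumes f: "step_bounded f F" and g: "step_bounded g G"
  shows "step_bounded (\<lambda>n. case prod_decode n of (a, m) \<Rightarrow>
      rec_nat (f a) (\<lambda>y r. Option.bind r (\<lambda>v. g (prod_encode (a, prod_encode (y, v))))) m)
    (\<lambda>x s. rec_nat (F (pfst x) s)
      (\<lambda>y r. if r = 0 then 0 else G (prod_encode (pfst x, prod_encode (y, r - 1))) s) (psnd x))"
    (is "step_bounded ?h ?H")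
proof -
  define R where "R = (\<lambda>a s. rec_nat (F a s)
      (\<lambda>y r. if r = 0 then 0 else G (prod_encode (a, prod_encode (y, r - 1))) s))"
  define r where "r = (\<lambda>a. rec_nat (f a) (\<lambda>y r. Option.bind r (\<lambda>v. g (prod_encode (a, prod_encode (y, v))))))"
  have R_Suc: "R a s (Suc m) = (if R a s m = 0 then 0 else G (prod_encode (a, prod_encode (m, R a s m - 1))) s)"
    and R_0: "R a s 0 = F a s" for a s m
    by (simp_all add: R_def)
  have r_Suc: "r a (Suc m) = Option.bind (r a m) (\<lambda>v. g (prod_encode (a, prod_encode (m, v))))"
    and r_0: "r a 0 = f a" for a m
    by (simp_all add: r_def)
  have mono: "R a s' m = Suc y" if "R a s m = Suc y" "s \<le> s'" for a s s' m y
    using that(1)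
  proof (induction m arbitrary: y)
    case 0
    then show ?case unfolding R_0 using that(2) by (rule step_boundedD(2)[OF f])
  next
    case (Suc m)
    then obtain v where v: "R a s m = Suc v" "G (prod_encode (a, prod_encode (m, v))) s = Suc y"
      by (auto simp: R_Suc gr0_conv_Suc split: if_splits)
    then have "R a s' m = Suc v" using Suc.IH by blast
    moreover have "G (prod_encode (a, prod_encode (m, v))) s' = Suc y"
      using v(2) that(2) by (rule step_boundedD(2)[OF g])
    ultimately show ?case by (simp add: R_Suc)
  qed
  have conv: "r a m = Some y \<longleftrightarrow> (\<exists>s. R a s m = Suc y)" for a m y
  proof (induction m arbitrary: y)
    case 0
    then show ?case using step_boundedD(3)[OF f] by (simp add: R_0 r_0)
  next
    case (Suc m)
    show ?case
    proof
      assume "r a (Suc m) = Some y"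
      then obtain v where v: "r a m = Some v" "g (prod_encode (a, prod_encode (m, v))) = Some y"
        by (auto simp: r_Suc Option.bind_eq_Some_conv)
      then obtain s s' where "R a s m = Suc v" "G (prod_encode (a, prod_encode (m, v))) s' = Suc y"
        using Suc.IH step_boundedD(3)[OF g] by blast
      then have "R a (max s s') m = Suc v" "G (prod_encode (a, prod_encode (m, v))) (max s s') = Suc y"
        using mono[of a s m v "max s s'"] step_boundedD(2)[OF g, of _ s' _ "max s s'"] by auto
      then show "\<exists>s. R a s (Suc m) = Suc y" by (intro exI[of _ "max s s'"]) (simp add: R_Suc)
    next
      assume "\<exists>s. R a s (Suc m) = Suc y"
      then obtain s v where v: "R a s m = Suc v" "G (prod_encode (a, prod_encode (m, v))) s = Suc y"
        by (auto simp: R_Suc gr0_conv_Suc split: if_splits)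
      then have "r a m = Some v" "g (prod_encode (a, prod_encode (m, v))) = Some y"
        using Suc.IH step_boundedD(3)[OF g] by blast+
      then show "r a (Suc m) = Some y" by (simp add: r_Suc)
    qed
  qed
  have "computable2 (\<lambda>x s. R (pfst x) s (psnd x))"
    unfolding R_def
    by (intro computable_rules computable_rec_nat computable2D[OF step_boundedD(1)[OF f]]
        computable2D[OF step_boundedD(1)[OF g]])
  then have "step_bounded (\<lambda>n. r (pfst n) (psnd n)) (\<lambda>x s. R (pfst x) s (psnd x))"
    unfolding step_bounded_def using mono conv by blast
  then show ?thesis by (simp add: R_def r_def case_prod_beta)
qed

text \<open>In the shifted coding \<open>1\<close> means the value zero and anything above
  \<open>1\<close> a known nonzero value, so \<open>m\<close> counts as a hit only after all smaller
  arguments have converged. The disjunct \<open>s \<le> m\<close> makes the inner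
  \<open>LEAST\<close> total; it does not interfere when there is a hit below
  \<open>s\<close>.\<close>

lemma step_bounded_search:
  assumes f: "step_bounded f F"
  shows "step_bounded (mu_search f)
    (\<lambda>x s. if \<exists>m<s. F (prod_encode (x, m)) s = Suc 0 \<and> (\<forall>j<m. 1 < F (prod_encode (x, j)) s)
      then Suc (LEAST m. s \<le> m \<or> F (prod_encode (x, m)) s = Suc 0) else 0)"
    (is "step_bounded ?h ?H")
proof -
  define hit where "hit = (\<lambda>x s m. F (prod_encode (x, m)) s = Suc 0 \<and> (\<forall>j<m. 1 < F (prod_encode (x, j)) s))"
  define Hit where "Hit = (\<lambda>x m. f (prod_encode (x, m)) = Some 0 \<and>
      (\<forall>j<m. \<exists>v. f (prod_encode (x, j)) = Some v \<and> v \<noteq> 0))"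
  have least_hit: "(LEAST m. s \<le> m \<or> F (prod_encode (x, m)) s = Suc 0) = m"
    if "m < s" "hit x s m" for x s m
  proof (rule Least_equality)
    show "s \<le> m \<or> F (prod_encode (x, m)) s = Suc 0" using that by (simp add: hit_def)
    show "m \<le> n" if "s \<le> n \<or> F (prod_encode (x, n)) s = Suc 0" for n
    proof (rule ccontr)
      assume "\<not> m \<le> n"
      then have "1 < F (prod_encode (x, n)) s" "n < s"
        using \<open>hit x s m\<close> \<open>m < s\<close> by (simp_all add: hit_def)
      then show False using that by simp
    qed
  qed
  have H_eq: "?H x s = (if \<exists>m<s. hit x s m
      then Suc (LEAST m. s \<le> m \<or> F (prod_encode (x, m)) s = Suc 0) else 0)" for x s
    by (simp only: hit_def)
  have H_iff: "?H x s = Suc y \<longleftrightarrow> y < s \<and> hit x s y" for x s y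
    unfolding H_eq using least_hit by (metis nat.inject nat.distinct(1))
  have Hit_unique: "Hit x m \<Longrightarrow> Hit x m' \<Longrightarrow> m = m'" for x m m'
    unfolding Hit_def by (metis linorder_neqE_nat option.inject)
  have h_iff: "mu_search f x = Some y \<longleftrightarrow> Hit x y" for x y
  proof -
    have eq: "mu_search f x = (if \<exists>m. Hit x m then Some (LEAST m. Hit x m) else None)"
      unfolding mu_search_def Let_def Hit_def by (rule refl)
    show ?thesis
    proof
      assume "mu_search f x = Some y"
      then have "\<exists>m. Hit x m" "y = (LEAST m. Hit x m)" by (auto simp: eq split: if_splits)
      then show "Hit x y" by (metis LeastI)
    next
      assume y: "Hit x y"
      then have "(LEAST m. Hit x m) = y" using Hit_unique[OF LeastI[of "Hit x", OF y] y] by simp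
      then show "mu_search f x = Some y" using y by (auto simp: eq)
    qed
  qed
  have F_mono: "1 < F z s \<Longrightarrow> s \<le> s' \<Longrightarrow> 1 < F z s'" for z s s'
    by (metis One_nat_def Suc_lessE step_boundedD(2)[OF f])
  have mono: "hit x s' m" if "hit x s m" "s \<le> s'" for x s s' m
    using that step_boundedD(2)[OF f] F_mono unfolding hit_def by blast
  have Hit_iff: "Hit x m \<longleftrightarrow> (\<exists>s. m < s \<and> hit x s m)" for x m
  proof
    assume "Hit x m"
    then obtain s0 where s0: "F (prod_encode (x, m)) s0 = Suc 0"
      using step_boundedD(3)[OF f] unfolding Hit_def by blast
    \<comment> \<open>Only finitely many values have to converge, so their stages have a common
      bound.\<close>
    have "\<exists>s. \<forall>j<i. 1 < F (prod_encode (x, j)) s" if "i \<le> m" for i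
      using that
    proof (induction i)
      case (Suc i)
      then obtain s where s: "\<forall>j<i. 1 < F (prod_encode (x, j)) s" by auto
      obtain v where "f (prod_encode (x, i)) = Some v" "v \<noteq> 0"
        using \<open>Hit x m\<close> Suc.prems Suc_le_lessD unfolding Hit_def by blast
      then obtain s' where "1 < F (prod_encode (x, i)) s'"
        using step_boundedD(3)[OF f] by (metis One_nat_def Suc_less_eq neq0_conv)
      then have "\<forall>j<Suc i. 1 < F (prod_encode (x, j)) (max s s')"
        using s F_mono by (metis less_Suc_eq max.cobounded1 max.cobounded2)
      then show ?case by blast
    qed simp
    then obtain s1 where s1: "\<forall>j<m. 1 < F (prod_encode (x, j)) s1" by blast
    define s where "s = Suc m + s0 + s1"
    have "hit x s m"
      unfolding hit_def using s1 F_mono[of _ s1 s] step_boundedD(2)[OF f s0, of s] by (auto simp: s_def)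
    then show "\<exists>s. m < s \<and> hit x s m" by (intro exI[of _ s]) (simp add: s_def)
  next
    assume "\<exists>s. m < s \<and> hit x s m"
    then obtain s where s: "hit x s m" by blast
    then have "f (prod_encode (x, m)) = Some 0"
      using step_boundedD(3)[OF f] unfolding hit_def by blast
    moreover have "\<exists>v. f (prod_encode (x, j)) = Some v \<and> v \<noteq> 0" if "j < m" for j
      using s that step_boundedD(3)[OF f] unfolding hit_def
      by (metis One_nat_def Suc_lessE less_numeral_extra(3))
    ultimately show "Hit x m" unfolding Hit_def by blast
  qed
  have least: "computable2 (\<lambda>x s. LEAST m. s \<le> m \<or> F (prod_encode (x, m)) s = Suc 0)"
    unfolding computable2_def
    by (rule computable_Least, blast)
      (intro computable_rules computable2D[OF step_boundedD(1)[OF f]])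
  have "computable2 ?H"
    by (intro computable_rules computable2D[OF step_boundedD(1)[OF f]] computable2D[OF least])
  then show ?thesis
    unfolding step_bounded_def H_iff h_iff Hit_iff
    using mono by (meson less_le_trans)
qed

text \<open>Applied to the optimal function, this makes the strings of small complexity enumerable
  in stages.\<close>

lemma step_bounded_exists:
  assumes "partial_recursive g"
  shows "\<exists>T. step_bounded g T"
  using assms
proof (induction rule: partial_recursive.induct)
  case (pair f g)
  then show ?case using step_bounded_pair by blast
next
  case (comp f g)
  then show ?case using step_bounded_comp by blast
next
  case (prec f g)
  then show ?case using step_bounded_prec by blast
next
  case (search f)
  then show ?case using step_bounded_search by blast
qed (rule exI, rule step_bounded_total, intro computable_rules)+

section \<open>Lengths of strings, read off their codes\<close>

definition code_length :: "nat \<Rightarrow> nat" where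
  "code_length x = (LEAST l. Suc x < 2 ^ Suc l)"

text \<open>The code of the \<open>v\<close>-th string of length \<open>n\<close>, for \<open>v < 2 ^ n\<close>.\<close>

definition nth_code :: "nat \<Rightarrow> nat \<Rightarrow> nat" where
  "nth_code n v = 2 ^ n - 1 + v"

lemma code_length_eq_iff: "code_length x = l \<longleftrightarrow> 2 ^ l \<le> Suc x \<and> Suc x < 2 ^ Suc l"
proof -
  have upper: "Suc x < 2 ^ Suc (code_length x)"
    unfolding code_length_def
    by (rule LeastI[of _ "Suc x"]) (metis Suc_lessD less_exp lessI less_trans)
  have lower: "2 ^ code_length x \<le> Suc x"
  proof (cases "code_length x")
    case (Suc l)
    then have "l < (LEAST l. Suc x < 2 ^ Suc l)" by (simp only: code_length_def[symmetric])
    from not_less_Least[OF this] Suc show ?thesis by simp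
  qed simp
  have "code_length x = l" if l: "2 ^ l \<le> Suc x" "Suc x < 2 ^ Suc l"
  proof -
    have "(2::nat) ^ l < 2 ^ Suc (code_length x)" "(2::nat) ^ code_length x < 2 ^ Suc l"
      using l upper lower by linarith+
    moreover have "(1::nat) < 2" by simp
    ultimately have "l < Suc (code_length x)" "code_length x < Suc l"
      using power_less_imp_less_exp by blast+
    then show ?thesis by simp
  qed
  then show ?thesis using upper lower by blast
qed

lemma code_length_nth_code: "v < 2 ^ n \<Longrightarrow> code_length (nth_code n v) = n"
  by (simp add: code_length_eq_iff nth_code_def)

lemma nth_code_inj: "nth_code n v = nth_code n w \<longleftrightarrow> v = w"
  unfolding nth_code_def by linarith

lemma code_length_cases:
  assumes "code_length x = n"
  obtains v where "v < 2 ^ n" "x = nth_code n v"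
proof
  show "x - (2 ^ n - 1) < 2 ^ n" "x = nth_code n (x - (2 ^ n - 1))"
    using assms by (auto simp: code_length_eq_iff nth_code_def)
qed

lemma code_length_less_iff: "code_length x < l \<longleftrightarrow> x < 2 ^ l - 1"
proof -
  have *: "2 ^ code_length x \<le> Suc x" "Suc x < 2 ^ Suc (code_length x)"
    using code_length_eq_iff by blast+
  show ?thesis
  proof
    assume "code_length x < l"
    then have "(2::nat) ^ Suc (code_length x) \<le> 2 ^ l" by (intro power_increasing) auto
    then show "x < 2 ^ l - 1" using * by linarith
  next
    assume "x < 2 ^ l - 1"
    then have "(2::nat) ^ code_length x < 2 ^ l" using * by linarith
    then show "code_length x < l" by simp
  qed
qed

lemma computable_code_length: "computable_nat f \<Longrightarrow> computable_nat (\<lambda>x. code_length (f x))"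
proof (rule computable_compose[of code_length])
  have "\<exists>l. Suc x < 2 ^ Suc l" for x
    using code_length_eq_iff by blast
  then show "computable_nat code_length"
    unfolding code_length_def by (rule computable_Least) (intro computable_rules)
qed

lemma computable_nth_code:
  "computable_nat f \<Longrightarrow> computable_nat g \<Longrightarrow> computable_nat (\<lambda>x. nth_code (f x) (g x))"
  unfolding nth_code_def by (intro computable_rules)

text \<open>Prepending a bit turns \<open>y = Suc (str_code p)\<close> into \<open>2 * y\<close> or
  \<open>2 * y + 1\<close>, so it raises the integer part of the binary logarithm of
  \<open>y\<close> by one.\<close>

lemma code_length_str_code: "code_length (str_code p) = length p"
  unfolding code_length_eq_iff by (induction p) auto

lemma bij_str_code: "bij str_code"
proof (rule bijI)
  have "str_code p = str_code q \<Longrightarrow> p = q" for p q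
  proof (induction p arbitrary: q)
    case Nil
    then show ?case by (cases q) (auto split: if_splits)
  next
    case (Cons b p)
    then obtain c r where q: "q = c # r" by (cases q) (auto split: if_splits)
    \<comment> \<open>The parity of a nonzero code is its first bit: even for \<open>True\<close>,
      odd for \<open>False\<close>.\<close>
    have "b = c" using Cons.prems q by (auto split: if_splits dest: arg_cong[of _ _ even])
    then show ?case using Cons q by simp
  qed
  then show "inj str_code" by (rule injI)
next
  have "\<exists>p. str_code p = x" for x
  proof (induction x rule: less_induct)
    case (less x)
    show ?case
    proof (cases "x = 0")
      case False
      define b where "b \<longleftrightarrow> even x"
      define y where "y = (x - 1) div 2"
      have "x = 2 * y + (if b then 2 else 1)" "y < x"
        using False by (auto simp: y_def b_def elim!: evenE oddE)
      moreover from this less.IH obtain p where "str_code p = y" by blast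
      ultimately have "str_code (b # p) = x" by simp
      then show ?thesis by blast
    qed (auto intro: exI[of _ "[]"])
  qed
  then show "surj str_code" by (metis surjI)
qed

section \<open>Complexity on codes of strings\<close>

lemma partial_recursive_compose_total:
  assumes "partial_recursive g" "computable2 h"
  shows "partial_recursive (\<lambda>x. map_option (h x) (g x))"
proof -
  have "partial_recursive (\<lambda>n. Option.bind (Some n) (\<lambda>x. Option.bind (g n) (\<lambda>y. Some (prod_encode (x, y)))))"
    using computable_id assms(1) unfolding computable_nat_def by (rule partial_recursive.pair)
  from partial_recursive.comp[OF assms(2)[unfolded computable2_def computable_nat_def] this]
  show ?thesis by (simp add: map_conv_bind_option comp_def)
qed

text \<open>Optimality of the machine, transported along the bijection \<open>str_code\<close>, so
  that every computability argument stays on natural numbers. Here \<open>K\<close> is the plain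
  complexity of the string coded by its argument.\<close>

locale optimal_function =
  fixes u :: "nat \<Rightarrow> nat option"
  assumes recursive: "partial_recursive u"
    and optimal: "partial_recursive g \<Longrightarrow>
      \<exists>c. \<forall>p y. g p = Some y \<longrightarrow> (\<exists>q. u q = Some y \<and> code_length q \<le> code_length p + c)"
begin

definition K :: "nat \<Rightarrow> nat" where
  "K y = (LEAST l. \<exists>p. code_length p = l \<and> u p = Some y)"

lemma K_le: "u p = Some y \<Longrightarrow> K y \<le> code_length p"
  unfolding K_def by (rule Least_le) blast

lemma K_bound:
  assumes "partial_recursive g"
  shows "\<exists>c. \<forall>p y. g p = Some y \<longrightarrow> K y \<le> code_length p + c"
  using optimal[OF assms] K_le by (meson order_trans)

lemma K_le_length: "\<exists>c. \<forall>y. K y \<le> code_length y + c"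
  using K_bound[OF computable_id[unfolded computable_nat_def]] by simp

lemma K_witness: "\<exists>p. code_length p = K y \<and> u p = Some y"
proof -
  obtain p where "u p = Some y" using optimal[OF computable_id[unfolded computable_nat_def]] by auto
  then have "\<exists>q. code_length q = code_length p \<and> u q = Some y" by blast
  then show ?thesis unfolding K_def by (rule LeastI)
qed

text \<open>The programs shorter than \<open>l\<close> are the codes below \<open>2 ^ l - 1\<close>,
  so the search for a program becomes a bounded quantifier. This serves both to count simple strings
  and to enumerate them.\<close>

lemma K_less_iff: "K y < l \<longleftrightarrow> (\<exists>p < 2 ^ l - 1. u p = Some y)"
  using K_witness[of y] K_le[of _ y] code_length_less_iff by (metis le_less_trans)

lemma card_K_less:
  assumes "finite X" "\<And>x. x \<in> X \<Longrightarrow> K x < l"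
  shows "card X < 2 ^ l"
proof -
  have "X \<subseteq> (\<lambda>p. the (u p)) ` {..<2 ^ l - 1}"
  proof
    fix x assume "x \<in> X"
    then obtain p where "p < 2 ^ l - 1" "u p = Some x" using assms(2) K_less_iff by blast
    then show "x \<in> (\<lambda>p. the (u p)) ` {..<2 ^ l - 1}" by force
  qed
  then have "card X \<le> card {..<2 ^ l - (1::nat)}" by (meson finite_lessThan surj_card_le)
  also have "\<dots> < 2 ^ l" by simp
  finally show ?thesis .
qed

text \<open>
  The string \<open>0\<^sup>e 1 \<tau>\<close> determines \<open>e\<close>, the length \<open>t\<close> of \<open>\<tau>\<close>, and an index below \<open>2 ^ t\<close>, which
  selects an element of the decidable set \<open>Q e t\<close>.  Spending \<open>e\<close> bits on \<open>e\<close> itself lets a single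
  machine serve all constants \<open>e\<close>.
\<close>

lemma K_decidable_family:
  assumes Q: "decidable3 Q" and out: "computable3 out"
  shows "\<exists>c. \<forall>e t z. Q e t z \<longrightarrow> finite {z. Q e t z} \<longrightarrow> card {z. Q e t z} \<le> 2 ^ t \<longrightarrow>
    K (out e t z) \<le> t + e + c"
proof -
  \<comment> \<open>\<open>val p\<close> is the position of \<open>p\<close> among the strings of
    its length. For the intended \<open>p\<close> it is \<open>2 ^ t + j\<close>, padded by
    \<open>e\<close> leading zeros: \<open>T\<close> finds \<open>t\<close> as its binary logarithm,
    \<open>J\<close> removes the leading one, and \<open>E\<close> is what remains of the
    length.\<close>
  define val where "val p = p - (2 ^ code_length p - 1)" for p
  define T where "T p = code_length (val p - 1)" for p
  define E where "E p = code_length p - 1 - T p" for p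
  define J where "J p = val p - 2 ^ T p" for p
  have val: "computable_nat val" unfolding val_def
    by (intro computable_rules computable_code_length)
  have T: "computable_nat T" unfolding T_def
    by (intro computable_rules computable_code_length val)
  have E: "computable_nat E" unfolding E_def
    by (intro computable_rules computable_code_length T)
  have J: "computable_nat J" unfolding J_def
    by (intro computable_rules val T)
  \<comment> \<open>\<open>P p z\<close> selects the element of rank \<open>J p\<close> in
    increasing order. The rank only looks below \<open>z\<close>, so the machine never needs the
    whole set or a bound for it.\<close>
  define P where "P p z \<longleftrightarrow> Q (E p) (T p) z \<and> card {w. w < z \<and> Q (E p) (T p) w} = J p" for p z
  have P: "decidable2 P" unfolding P_def
    by (intro computable_rules decidable3D[OF Q] computable_compose[OF E] computable_compose[OF T]
        computable_compose[OF J])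
  define g where "g p = map_option (out (E p) (T p)) (if \<exists>z. P p z then Some (LEAST z. P p z) else None)" for p
  have "partial_recursive g" unfolding g_def
    by (intro partial_recursive_compose_total partial_recursive_Least P computable2I computable3D[OF out]
       computable_compose[OF E] computable_compose[OF T] computable_rules)
  then obtain c where c: "\<And>p y. g p = Some y \<Longrightarrow> K y \<le> code_length p + c"
    using K_bound by blast
  have "K (out e t z) \<le> t + e + (1 + c)"
    if z: "Q e t z" and fin: "finite {z. Q e t z}" and card: "card {z. Q e t z} \<le> 2 ^ t" for e t z
  proof -
    define j where "j = card {w. w < z \<and> Q e t w}"
    have "{w. w < z \<and> Q e t w} \<subset> {z. Q e t z}" using z by auto
    then have "j < card {z. Q e t z}" unfolding j_def using fin psubset_card_mono by blast
    then have j: "j < 2 ^ t" using card by simp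
    define p where "p = nth_code (t + e + 1) (2 ^ t + j)"
    have "2 ^ t + j < 2 ^ (t + 1)" using j by simp
    also have "(2::nat) ^ (t + 1) \<le> 2 ^ (t + e + 1)" by (intro power_increasing) auto
    finally have lenp: "code_length p = t + e + 1" by (simp add: p_def code_length_nth_code)
    have "val p = 2 ^ t + j" unfolding val_def lenp by (simp add: p_def nth_code_def)
    moreover have "code_length (2 ^ t + j - 1) = t"
      using j by (simp add: code_length_eq_iff)
    ultimately have pT: "T p = t" and pJ: "J p = j" by (simp_all add: T_def J_def)
    then have pE: "E p = e" by (simp add: E_def lenp)
    have P_z: "P p z" using z by (simp add: P_def pT pJ pE j_def)
    have "(LEAST z. P p z) = z"
    proof (rule Least_equality)
      show "P p z" by (rule P_z)
    next
      fix y assume y: "P p y"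
      show "z \<le> y"
      proof (rule ccontr)
        assume "\<not> z \<le> y"
        then have yz: "y < z" by simp
        have Qy: "Q e t y" using y unfolding P_def pT pE by blast
        have "{w. w < y \<and> Q e t w} \<subseteq> {w. w < z \<and> Q e t w}"
          using yz by (blast intro: less_trans)
        moreover have "y \<in> {w. w < z \<and> Q e t w}" using yz Qy by blast
        moreover have "y \<notin> {w. w < y \<and> Q e t w}" by blast
        ultimately have "{w. w < y \<and> Q e t w} \<subset> {w. w < z \<and> Q e t w}" by blast
        moreover have "finite {w. w < z \<and> Q e t w}" by simp
        ultimately have "card {w. w < y \<and> Q e t w} < j"
          unfolding j_def using psubset_card_mono by blast
        then show False using y by (simp add: P_def pT pE pJ)
      qed
    qed
    then have "g p = Some (out e t z)" using P_z by (auto simp: g_def pT pE)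
    from c[OF this] show ?thesis by (simp add: lenp)
  qed
  then show ?thesis by blast
qed

end

text \<open>The statement of membership in \<open>EXT\<close>, with strings replaced by their codes.\<close>

definition (in optimal_function) EXT_code :: "nat \<Rightarrow> real \<Rightarrow> real \<Rightarrow> bool" where
  "EXT_code k \<alpha> \<beta> \<longleftrightarrow> (\<exists>(f :: nat \<Rightarrow> nat) (\<gamma> :: nat \<Rightarrow> nat \<Rightarrow> nat) (d :: nat).
      computable_nat f \<and> inj f \<and> (\<forall>i\<in>{1..k}. computable_nat (\<gamma> i)) \<and>
      (\<forall>n x. code_length x = f n \<longrightarrow>
        (\<forall>i\<in>{1..k}. code_length (\<gamma> i x) = n) \<and>
        (real (K x) \<ge> \<alpha> * real (f n) + real d \<longrightarrow>
          (\<exists>i\<in>{1..k}. real (K (\<gamma> i x)) \<ge> \<beta> * real n - real d))))"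

lemma optimal_machine_function:
  assumes "optimal_machine U"
  obtains u where "optimal_function u" "\<And>p. u (str_code p) = map_option str_code (U p)"
proof -
  obtain u where u: "partial_recursive u" "\<And>p. u (str_code p) = map_option str_code (U p)"
    using assms by (auto simp: optimal_machine_def partial_computable_str_def)
  define dec where "dec = inv str_code"
  have dec: "dec (str_code p) = p" "str_code (dec x) = x" for p x
    unfolding dec_def using bij_str_code by (simp_all add: bij_is_inj bij_is_surj surj_f_inv_f)
  have "optimal_function u"
  proof
    fix g assume g: "partial_recursive g"
    define M where "M p = map_option dec (g (str_code p))" for p
    have "partial_computable_str M"
      unfolding partial_computable_str_def M_def using g
      by (intro exI[of _ g]) (auto simp: dec option.map_comp comp_def option.map_ident)
    then obtain c where c: "\<And>p \<sigma>. M p = Some \<sigma> \<Longrightarrow> \<exists>q. U q = Some \<sigma> \<and> length q \<le> length p + c"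
      using assms unfolding optimal_machine_def by blast
    have "\<exists>q. u q = Some y \<and> code_length q \<le> code_length p + c" if "g p = Some y" for p y
    proof -
      have "M (dec p) = Some (dec y)" using that by (simp add: M_def dec)
      from c[OF this] obtain q where "U q = Some (dec y)" "length q \<le> length (dec p) + c" by blast
      then show ?thesis
        using u(2)[of q] code_length_str_code[of "dec p"] code_length_str_code[of q]
        by (intro exI[of _ "str_code q"]) (simp add: dec)
    qed
    then show "\<exists>c. \<forall>p y. g p = Some y \<longrightarrow> (\<exists>q. u q = Some y \<and> code_length q \<le> code_length p + c)"
      by blast
  qed (rule u(1))
  then show ?thesis using u(2) that by blast
qed

lemma EXT_iff_code:
  assumes u: "optimal_function u" "\<And>p. u (str_code p) = map_option str_code (U p)"
    and "\<alpha> \<in> {0..1}" "\<beta> \<in> {0..1}"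
  shows "(\<alpha>, \<beta>) \<in> EXT U k \<longleftrightarrow> optimal_function.EXT_code u k \<alpha> \<beta>"
proof -
  interpret optimal_function u by (rule u(1))
  define dec where "dec = inv str_code"
  have dec: "dec (str_code p) = p" "str_code (dec x) = x" for p x
    unfolding dec_def using bij_str_code by (simp_all add: bij_is_inj bij_is_surj surj_f_inv_f)
  have len: "length (dec x) = code_length x" for x
    using code_length_str_code[of "dec x"] by (simp add: dec)
  have C: "plain_complexity U p = K (str_code p)" for p
  proof -
    have "(\<exists>q. length q = l \<and> U q = Some p) \<longleftrightarrow> (\<exists>q. code_length q = l \<and> u q = Some (str_code p))" for l
      using u(2) by (metis (no_types, opaque_lifting) code_length_str_code dec map_option_eq_Some)
    then show ?thesis by (simp add: plain_complexity_def K_def)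
  qed
  show ?thesis
  proof
    assume "(\<alpha>, \<beta>) \<in> EXT U k"
    then obtain f \<Gamma> d where f: "computable_nat f" "inj f" and \<Gamma>: "\<forall>i\<in>{1..k}. computable_str (\<Gamma> i)"
      and ext: "\<And>n \<sigma>. length \<sigma> = f n \<Longrightarrow> (\<forall>i\<in>{1..k}. length (\<Gamma> i \<sigma>) = n) \<and>
        (real (plain_complexity U \<sigma>) \<ge> \<alpha> * real (length \<sigma>) + real d \<longrightarrow>
          (\<exists>i\<in>{1..k}. real (plain_complexity U (\<Gamma> i \<sigma>)) \<ge> \<beta> * real (length (\<Gamma> i \<sigma>)) - real d))"
      unfolding EXT_def by blast
    define \<gamma> where "\<gamma> i x = str_code (\<Gamma> i (dec x))" for i x
    have "computable_nat (\<gamma> i)" if i: "i \<in> {1..k}" for i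
    proof -
      obtain g where g: "partial_recursive g" "\<And>p. g (str_code p) = Some (str_code (\<Gamma> i p))"
        using bspec[OF \<Gamma> i] by (auto simp: computable_str_def partial_computable_str_def)
      have "g = (\<lambda>x. Some (\<gamma> i x))"
      proof
        show "g x = Some (\<gamma> i x)" for x using g(2)[of "dec x"] by (simp add: \<gamma>_def dec)
      qed
      then show ?thesis using g(1) by (simp add: computable_nat_def)
    qed
    moreover have "(\<forall>i\<in>{1..k}. code_length (\<gamma> i x) = n) \<and>
        (real (K x) \<ge> \<alpha> * real (f n) + real d \<longrightarrow>
          (\<exists>i\<in>{1..k}. real (K (\<gamma> i x)) \<ge> \<beta> * real n - real d))" if "code_length x = f n" for n x
      using ext[of "dec x" n] that by (auto simp: len C dec \<gamma>_def code_length_str_code)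
    ultimately show "EXT_code k \<alpha> \<beta>" unfolding EXT_code_def using f by blast
  next
    assume "EXT_code k \<alpha> \<beta>"
    then obtain f \<gamma> d where f: "computable_nat f" "inj f" and \<gamma>: "\<forall>i\<in>{1..k}. computable_nat (\<gamma> i)"
      and ext: "\<And>n x. code_length x = f n \<Longrightarrow> (\<forall>i\<in>{1..k}. code_length (\<gamma> i x) = n) \<and>
        (real (K x) \<ge> \<alpha> * real (f n) + real d \<longrightarrow>
          (\<exists>i\<in>{1..k}. real (K (\<gamma> i x)) \<ge> \<beta> * real n - real d))"
      unfolding EXT_code_def by blast
    define \<Gamma> where "\<Gamma> i p = dec (\<gamma> i (str_code p))" for i p
    have "computable_str (\<Gamma> i)" if i: "i \<in> {1..k}" for i
      unfolding computable_str_def partial_computable_str_def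
      using \<gamma> i by (intro exI[of _ "\<lambda>x. Some (\<gamma> i x)"]) (auto simp: computable_nat_def \<Gamma>_def dec)
    moreover have "(\<forall>i\<in>{1..k}. length (\<Gamma> i \<sigma>) = n) \<and>
        (real (plain_complexity U \<sigma>) \<ge> \<alpha> * real (length \<sigma>) + real d \<longrightarrow>
          (\<exists>i\<in>{1..k}. real (plain_complexity U (\<Gamma> i \<sigma>)) \<ge> \<beta> * real (length (\<Gamma> i \<sigma>)) - real d))"
      if "length \<sigma> = f n" for n \<sigma>
      using ext[of "str_code \<sigma>" n] that by (auto simp: len C dec \<Gamma>_def code_length_str_code)
    ultimately show "(\<alpha>, \<beta>) \<in> EXT U k" unfolding EXT_def using f assms(3,4) by blast
  qed
qed

section \<open>Approximating computable reals\<close>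

text \<open>At argument \<open>m\<close> precision \<open>1 / 2 ^ m\<close> suffices, because
  multiplying by \<open>m\<close> leaves an error of at most \<open>1\<close>; rounding down costs
  another \<open>1\<close>. Truncated subtraction does no harm since \<open>x\<close> is
  nonnegative.\<close>

lemma computable_real_approx:
  assumes "computable_real x" "0 \<le> x"
  obtains h where "computable_nat h" "\<And>m. \<bar>real (h m) - x * real m\<bar> \<le> 2"
proof -
  obtain a b c where comp: "computable_nat a" "computable_nat b" "computable_nat c"
    and c: "\<And>n. c n > 0" and x: "\<And>n. \<bar>x - (real (a n) - real (b n)) / real (c n)\<bar> \<le> 1 / 2 ^ n"
    using assms(1) unfolding computable_real_def by blast
  define h where "h m = (m * (a m - b m)) div c m" for m
  have "computable_nat h" unfolding h_def by (intro computable_rules comp)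
  moreover have "\<bar>real (h m) - x * real m\<bar> \<le> 2" for m
  proof -
    define q where "q = real (a m - b m) / real (c m)"
    have "\<bar>x - q\<bar> \<le> 1 / 2 ^ m"
    proof (cases "b m \<le> a m")
      case True
      then show ?thesis using x[of m] by (simp add: q_def of_nat_diff)
    next
      case False
      then have "(real (a m) - real (b m)) / real (c m) \<le> 0" by (simp add: divide_nonpos_nonneg)
      then show ?thesis using x[of m] assms(2) False by (simp add: q_def abs_if split: if_splits)
    qed
    then have "real m * \<bar>x - q\<bar> \<le> real m * (1 / 2 ^ m)" by (rule mult_left_mono) simp
    also have "\<dots> \<le> 1" using of_nat_less_two_power[of m, where 'a=real] by simp
    also have "real m * \<bar>x - q\<bar> = \<bar>real m * (x - q)\<bar>" by (simp add: abs_mult)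
    finally have 1: "\<bar>x * real m - real m * q\<bar> \<le> 1" by (simp add: algebra_simps)
    have "real (h m) = of_int \<lfloor>real (m * (a m - b m)) / real (c m)\<rfloor>"
      unfolding h_def floor_divide_of_nat_eq by simp
    moreover have "real (m * (a m - b m)) / real (c m) = real m * q" by (simp add: q_def)
    ultimately have "real (h m) \<le> real m * q" "real m * q < real (h m) + 1" by linarith+
    then show ?thesis using 1 by linarith
  qed
  ultimately show ?thesis by (rule that)
qed

text \<open>A machine that is only given the number \<open>h m\<close>, in the form of a description
  length, can compute \<open>m\<close> up to the remainder \<open>r\<close>, a constant amount of
  advice. Positivity of \<open>x\<close> keeps that remainder bounded.\<close>

lemma approx_inverse:
  assumes h: "computable_nat h" "\<And>m. \<bar>real (h m) - x * real m\<bar> \<le> 2" and x: "0 < x" "x \<le> 1"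
  obtains g R where "computable_nat g" "\<And>l. \<bar>x * real (g l) - real l\<bar> \<le> 3"
    "\<And>m. \<exists>r\<le>R. m = g (h m) + r"
proof -
  define g where "g l = (LEAST m. l \<le> h m)" for l
  have ex: "\<exists>m. l \<le> h m" for l
  proof -
    obtain m where "(real l + 2) / x < real m" using reals_Archimedean2 by blast
    then have "real l + 2 < x * real m" using x by (simp add: field_simps)
    then show ?thesis using h(2)[of m] by (intro exI[of _ m]) linarith
  qed
  have comp: "computable_nat g" unfolding g_def
    by (rule computable_Least[OF ex]) (intro computable_rules computable_compose[OF h(1)])
  have ge: "l \<le> h (g l)" for l unfolding g_def using ex by (rule LeastI_ex)
  have bound: "\<bar>x * real (g l) - real l\<bar> \<le> 3" for l
  proof -
    have "x * real (g l) \<ge> real l - 2" using ge[of l] h(2)[of "g l"] by linarith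
    moreover have "x * real (g l) \<le> real l + 3"
    proof (cases "g l")
      case (Suc m)
      then have "\<not> l \<le> h m" unfolding g_def using not_less_Least[of m "\<lambda>m. l \<le> h m"] by auto
      then have "x * real m \<le> real l + 2" using h(2)[of m] by linarith
      then show ?thesis using Suc x by (simp add: algebra_simps)
    qed simp
    ultimately show ?thesis by linarith
  qed
  \<comment> \<open>The error \<open>3\<close> of the inverse and the error \<open>2\<close> of
    \<open>h\<close> add up to \<open>5\<close>.\<close>
  have "\<exists>r\<le>nat \<lceil>5 / x\<rceil>. m = g (h m) + r" for m
  proof -
    have le: "g (h m) \<le> m" unfolding g_def by (rule Least_le) simp
    have "x * real m - x * real (g (h m)) \<le> 5" using bound[of "h m"] h(2)[of m] by linarith
    then have "real m - real (g (h m)) \<le> 5 / x" using x by (simp add: field_simps)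
    then have "real (m - g (h m)) \<le> 5 / x" using le by (simp add: of_nat_diff)
    then have "m - g (h m) \<le> nat \<lceil>5 / x\<rceil>" by linarith
    then show ?thesis using le by (intro exI[of _ "m - g (h m)"]) simp
  qed
  then show ?thesis using that comp bound by blast
qed

text \<open>Inverting the approximation of \<alpha> \<open>m\<close> at the approximation of \<beta>
  \<open>n\<close> produces the slope \<beta> / \<alpha>. Strict growth is enforced by stepping to
  the successor of the previous value where necessary; this never overtakes the line shifted by
  \<open>c\<close>, because \<alpha> < \<beta> makes the slope at least \<open>1\<close>.\<close>

lemma computable_linear_strict_mono:
  assumes "computable_real \<alpha>" "computable_real \<beta>" "0 < \<alpha>" "\<alpha> < \<beta>" "\<beta> \<le> 1"
  obtains f :: "nat \<Rightarrow> nat" and c :: nat where "computable_nat f" "strict_mono f"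
    "\<And>n. \<bar>real (f n) - \<beta> / \<alpha> * real n\<bar> \<le> real c"
proof -
  obtain A where A: "computable_nat A" "\<And>m. \<bar>real (A m) - \<alpha> * real m\<bar> \<le> 2"
    using computable_real_approx[OF assms(1)] assms by (metis less_imp_le)
  obtain B where B: "computable_nat B" "\<And>m. \<bar>real (B m) - \<beta> * real m\<bar> \<le> 2"
    using computable_real_approx[OF assms(2)] assms by (metis less_imp_le less_trans)
  obtain g where g: "computable_nat g" "\<And>l. \<bar>\<alpha> * real (g l) - real l\<bar> \<le> 3"
    using approx_inverse[OF A] assms by (metis less_imp_le less_le_trans)
  define F where "F n = g (B n)" for n
  define c where "c = nat \<lceil>5 / \<alpha>\<rceil>"
  define \<gamma> where "\<gamma> = \<beta> / \<alpha>"
  have \<gamma>: "1 \<le> \<gamma>" using assms by (simp add: \<gamma>_def field_simps)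
  have F: "\<bar>real (F n) - \<gamma> * real n\<bar> \<le> real c" for n
  proof -
    have "\<bar>\<alpha> * real (F n) - \<beta> * real n\<bar> \<le> 5" using g(2)[of "B n"] B(2)[of n] unfolding F_def by linarith
    moreover have "\<alpha> * real (F n) - \<beta> * real n = \<alpha> * (real (F n) - \<gamma> * real n)"
      using assms by (simp add: \<gamma>_def field_simps)
    ultimately have "\<alpha> * \<bar>real (F n) - \<gamma> * real n\<bar> \<le> 5" using assms by (simp add: abs_mult)
    then have "\<bar>real (F n) - \<gamma> * real n\<bar> \<le> 5 / \<alpha>" using assms by (simp add: field_simps)
    then show ?thesis unfolding c_def by linarith
  qed
  define f where "f n = rec_nat (F 0) (\<lambda>y r. if r < F (Suc y) then F (Suc y) else Suc r) n" for n
  have F_comp: "computable_nat F" unfolding F_def by (rule computable_compose[OF g(1) B(1)])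
  have f_comp: "computable_nat f" unfolding f_def
    by (intro computable_rec_nat computable_rules computable_compose[OF F_comp])
  have f_Suc: "f (Suc n) = (if f n < F (Suc n) then F (Suc n) else Suc (f n))" for n
    by (simp add: f_def)
  have mono: "strict_mono f" by (simp add: strict_mono_Suc_iff f_Suc)
  have lower: "F n \<le> f n" for n
    by (cases n) (auto simp: f_Suc f_def)
  have upper: "real (f n) \<le> \<gamma> * real n + real c" for n
  proof (induction n)
    case 0
    then show ?case using F[of 0] by (simp add: f_def)
  next
    case (Suc n)
    show ?case
    proof (cases "f n < F (Suc n)")
      case True
      then show ?thesis using F[of "Suc n"] unfolding f_Suc by (simp add: abs_le_iff)
    next
      case False
      then show ?thesis using Suc \<gamma> by (simp add: f_Suc algebra_simps)
    qed
  qed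
  have "\<bar>real (f n) - \<gamma> * real n\<bar> \<le> real c" for n
    using upper[of n] lower[of n] F[of n] by linarith
  then show ?thesis using that f_comp mono unfolding \<gamma>_def by blast
qed

section \<open>Sparse systems of tuples\<close>

definition edges_in :: "nat \<Rightarrow> nat \<Rightarrow> (nat \<Rightarrow> nat \<Rightarrow> nat) \<Rightarrow> nat set \<Rightarrow> nat set" where
  "edges_in k m \<phi> W = {e. e < 2 ^ m \<and> (\<forall>i<k. \<phi> e i \<in> W)}"

text \<open>
  The hypergraph condition for tuples: the edge \<open>e\<close> consists of the vertices \<open>\<phi> e 0, \<dots>, \<phi> e (k - 1)\<close>,
  which need not be distinct.
\<close>

definition sparse_tuples ::
    "nat \<Rightarrow> nat \<Rightarrow> nat \<Rightarrow> real \<Rightarrow> real \<Rightarrow> (nat \<Rightarrow> nat \<Rightarrow> nat) \<Rightarrow> bool" where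
  "sparse_tuples k n m x y \<phi> \<longleftrightarrow> (\<forall>e<2 ^ m. \<forall>i<k. \<phi> e i < 2 ^ n) \<and>
    (\<forall>W\<subseteq>{..<2 ^ n}. real (card W) \<le> 2 powr x \<longrightarrow> real (card (edges_in k m \<phi> W)) < 2 powr y)"

lemma finite_edges_in: "finite (edges_in k m \<phi> W)"
  by (simp add: edges_in_def)

lemma card_edges_in_le: "card (edges_in k m \<phi> W) \<le> 2 ^ m"
proof -
  have "edges_in k m \<phi> W \<subseteq> {..<2 ^ m}" by (auto simp: edges_in_def)
  from card_mono[OF _ this] show ?thesis by simp
qed

lemma sparse_tuples_of_hypergraph:
  assumes G: "k_hypergraph k V E inc" "card V = 2 ^ n" "card E = 2 ^ m"
    and sparse: "\<And>W. W \<subseteq> V \<Longrightarrow> real (card W) \<le> 2 powr x \<Longrightarrow> real (edges_within E inc W) < 2 powr y"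
  shows "\<exists>\<phi>. sparse_tuples k n m x y \<phi>"
proof -
  have fin: "finite V" "finite E" using G by (auto simp: k_hypergraph_def)
  obtain v :: "_ \<Rightarrow> nat" where v: "bij_betw v V {..<2 ^ n}"
    using ex_bij_betw_finite_nat[OF fin(1)] G(2) by (auto simp: atLeast0LessThan)
  obtain h where h: "bij_betw h {..<2 ^ m :: nat} E"
    using ex_bij_betw_nat_finite[OF fin(2)] G(3) by (auto simp: atLeast0LessThan)
  have "\<exists>q. bij_betw q {..<k} (inc e)" if "e \<in> E" for e
  proof -
    have "finite (inc e)" "card (inc e) = k"
      using G(1) that finite_subset[OF _ fin(1)] by (auto simp: k_hypergraph_def)
    then show ?thesis using ex_bij_betw_nat_finite by (metis atLeast0LessThan)
  qed
  then obtain q where q: "\<And>e. e \<in> E \<Longrightarrow> bij_betw (q e) {..<k} (inc e)" by metis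
  define \<phi> where "\<phi> e i = v (q (h e) i)" for e i
  have hE: "h e \<in> E" if "e < 2 ^ m" for e using h that by (auto simp: bij_betw_def)
  have qV: "q (h e) i \<in> V" if "e < 2 ^ m" "i < k" for e i
  proof -
    have "q (h e) i \<in> inc (h e)" using q[OF hE[OF that(1)]] that(2) by (auto simp: bij_betw_def)
    then show ?thesis using G(1) hE[OF that(1)] by (auto simp: k_hypergraph_def)
  qed
  have "real (card (edges_in k m \<phi> W)) < 2 powr y"
    if W: "W \<subseteq> {..<2 ^ n}" "real (card W) \<le> 2 powr x" for W
  proof -
    define X where "X = {z \<in> V. v z \<in> W}"
    have "inj_on v X" using v by (auto simp: X_def bij_betw_def inj_on_def)
    moreover have "v ` X \<subseteq> W" by (auto simp: X_def)
    ultimately have "card X \<le> card W" using W(1) by (meson card_inj_on_le finite_lessThan finite_subset)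
    then have "real (edges_within E inc X) < 2 powr y"
      using W(2) by (intro sparse) (auto simp: X_def)
    moreover have "card (edges_in k m \<phi> W) \<le> edges_within E inc X"
      unfolding edges_within_def
    proof (rule card_inj_on_le)
      show "inj_on h (edges_in k m \<phi> W)"
        using h by (auto simp: bij_betw_def edges_in_def intro: inj_on_subset)
      show "finite {e \<in> E. inc e \<subseteq> X}" using fin(2) by simp
      show "h ` edges_in k m \<phi> W \<subseteq> {e \<in> E. inc e \<subseteq> X}"
      proof (rule image_subsetI)
        fix e assume e: "e \<in> edges_in k m \<phi> W"
        then have em: "e < 2 ^ m" by (simp add: edges_in_def)
        have "inc (h e) = q (h e) ` {..<k}" using q[OF hE[OF em]] by (simp add: bij_betw_def)
        moreover have "q (h e) i \<in> X" if "i < k" for i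
          using e that qV[OF em that] by (simp add: edges_in_def X_def \<phi>_def)
        ultimately have "inc (h e) \<subseteq> X" by auto
        then show "h e \<in> {e \<in> E. inc e \<subseteq> X}" using hE[OF em] by simp
      qed
    qed
    ultimately show ?thesis by linarith
  qed
  moreover have "\<phi> e i < 2 ^ n" if "e < 2 ^ m" "i < k" for e i
    using qV[OF that] v by (auto simp: \<phi>_def bij_betw_def)
  ultimately show ?thesis unfolding sparse_tuples_def by blast
qed

text \<open>A tuple with repetitions is padded to exactly \<open>k\<close> vertices, for which
  \<open>k \<le> 2 ^ n\<close> leaves room. Enlarging an edge can only remove it from a given vertex
  set, so sparsity survives.\<close>

lemma hypergraph_of_sparse_tuples:
  assumes \<phi>: "sparse_tuples k n m x y \<phi>" and k: "k \<le> 2 ^ n"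
  shows "\<exists>(V :: nat set) (E :: nat set) inc. k_hypergraph k V E inc \<and> card V = 2 ^ n \<and> card E = 2 ^ m \<and>
    (\<forall>W\<subseteq>V. real (card W) \<le> 2 powr x \<longrightarrow> real (edges_within E inc W) < 2 powr y)"
proof -
  have "\<exists>B. \<phi> e ` {..<k} \<subseteq> B \<and> B \<subseteq> {..<2 ^ n} \<and> card B = k" if "e < 2 ^ m" for e
  proof -
    have "\<phi> e ` {..<k} \<subseteq> {..<2 ^ n}" using \<phi> that by (auto simp: sparse_tuples_def)
    moreover have "card (\<phi> e ` {..<k}) \<le> k" using card_image_le[of "{..<k}" "\<phi> e"] by simp
    ultimately show ?thesis
      using exists_subset_between[of "\<phi> e ` {..<k}" k "{..<2 ^ n}"] k by auto
  qed
  then obtain inc where inc: "\<And>e. e < 2 ^ m \<Longrightarrow> \<phi> e ` {..<k} \<subseteq> inc e \<and> inc e \<subseteq> {..<2 ^ n} \<and> card (inc e) = k"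
    by metis
  have "k_hypergraph k {..<2 ^ n} {..<2 ^ m} inc" using inc by (auto simp: k_hypergraph_def)
  moreover have "real (edges_within {..<2 ^ m} inc W) < 2 powr y"
    if W: "W \<subseteq> {..<2 ^ n}" "real (card W) \<le> 2 powr x" for W
  proof -
    have "{e \<in> {..<2 ^ m}. inc e \<subseteq> W} \<subseteq> edges_in k m \<phi> W"
      using inc by (fastforce simp: edges_in_def)
    from card_mono[OF finite_edges_in this]
    have "edges_within {..<2 ^ m} inc W \<le> card (edges_in k m \<phi> W)" by (simp add: edges_within_def)
    moreover have "real (card (edges_in k m \<phi> W)) < 2 powr y" using \<phi> W by (auto simp: sparse_tuples_def)
    ultimately show ?thesis by linarith
  qed
  ultimately show ?thesis by (intro exI[of _ "{..<2 ^ n}"] exI[of _ "{..<2 ^ m}"] exI[of _ inc]) auto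
qed

section \<open>Covering vertex sets by blocks\<close>

text \<open>Cut \<open>W\<close> into \<open>M\<close> blocks of size \<open>s\<close>: every edge inside \<open>W\<close> lies in the union of \<open>k\<close> blocks.\<close>

lemma card_edges_in_blocks:
  assumes W: "finite W" "card W \<le> M * s"
    and T: "\<And>X. X \<subseteq> W \<Longrightarrow> card X \<le> k * s \<Longrightarrow> real (card (edges_in k m \<phi> X)) \<le> T"
  shows "real (card (edges_in k m \<phi> W)) \<le> real (M ^ k) * T"
proof -
  obtain v where v: "bij_betw v W {..<card W}"
    using ex_bij_betw_finite_nat[OF W(1)] by (auto simp: atLeast0LessThan)
  define blk where "blk z = v z div s" for z
  define X where "X b = {z \<in> W. blk z \<in> b ` {..<k}}" for b :: "nat \<Rightarrow> nat"
  have blk: "blk z < M" if "z \<in> W" for z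
  proof -
    have "v z < card W" using v that by (auto simp: bij_betw_def)
    then show ?thesis using W(2) unfolding blk_def by (intro less_mult_imp_div_less) simp
  qed
  have card_blk: "card {z \<in> W. blk z = c} \<le> s" for c
  proof (cases "s = 0")
    case True
    then show ?thesis using W by simp
  next
    case False
    have "inj_on v {z \<in> W. blk z = c}" using v by (auto simp: bij_betw_def inj_on_def)
    moreover have "v ` {z \<in> W. blk z = c} \<subseteq> {c * s..<c * s + s}"
      using False by (auto simp: blk_def dividend_less_div_times div_times_less_eq_dividend
          add.commute[of _ s])
    ultimately have "card {z \<in> W. blk z = c} \<le> card {c * s..<c * s + s}"
      by (meson card_inj_on_le finite_atLeastLessThan)
    then show ?thesis by simp
  qed
  have "card (X b) \<le> k * s" for b
  proof -
    have "X b = (\<Union>i<k. {z \<in> W. blk z = b i})" by (auto simp: X_def)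
    also have "card \<dots> \<le> (\<Sum>i<k. card {z \<in> W. blk z = b i})" by (rule card_UN_le) simp
    also have "\<dots> \<le> (\<Sum>i<k. s)" by (rule sum_mono) (rule card_blk)
    finally show ?thesis by simp
  qed
  then have TX: "real (card (edges_in k m \<phi> (X b))) \<le> T" for b by (intro T) (auto simp: X_def)
  \<comment> \<open>A pattern \<open>b\<close> records the block of each coordinate of an edge.
    There are \<open>M ^ k\<close> patterns, and the edges of one pattern lie in a union of at most
    \<open>k\<close> blocks.\<close>
  define B where "B = {..<k} \<rightarrow>\<^sub>E {..<M}"
  have B: "finite B" "card B = M ^ k" by (simp_all add: B_def finite_PiE card_PiE)
  have "edges_in k m \<phi> W \<subseteq> (\<Union>b\<in>B. edges_in k m \<phi> (X b))"
  proof
    fix e assume e: "e \<in> edges_in k m \<phi> W"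
    define b where "b = restrict (\<lambda>i. blk (\<phi> e i)) {..<k}"
    have "b \<in> B" using e blk by (auto simp: b_def B_def edges_in_def)
    moreover have "e \<in> edges_in k m \<phi> (X b)" using e by (auto simp: edges_in_def X_def b_def)
    ultimately show "e \<in> (\<Union>b\<in>B. edges_in k m \<phi> (X b))" by blast
  qed
  then have "card (edges_in k m \<phi> W) \<le> card (\<Union>b\<in>B. edges_in k m \<phi> (X b))"
    by (intro card_mono) (auto simp: B finite_edges_in)
  also have "\<dots> \<le> (\<Sum>b\<in>B. card (edges_in k m \<phi> (X b)))" by (rule card_UN_le[OF B(1)])
  finally have "real (card (edges_in k m \<phi> W)) \<le> (\<Sum>b\<in>B. real (card (edges_in k m \<phi> (X b))))"
    by (metis of_nat_le_iff of_nat_sum)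
  also have "\<dots> \<le> (\<Sum>b\<in>B. T)" by (rule sum_mono) (rule TX)
  finally show ?thesis by (simp add: B)
qed

lemma sparse_tuples_blocks:
  assumes \<phi>: "sparse_tuples k n m x y \<phi>" and W: "W \<subseteq> {..<2 ^ n}" "card W \<le> M * s"
    and s: "real (k * s) \<le> 2 powr x"
  shows "real (card (edges_in k m \<phi> W)) \<le> real (M ^ k) * 2 powr y"
proof (rule card_edges_in_blocks[OF _ W(2)])
  show "finite W" using W(1) finite_subset by blast
  fix X assume X: "X \<subseteq> W" "card X \<le> k * s"
  then have "real (card X) \<le> 2 powr x" using s by linarith
  moreover have "X \<subseteq> {..<2 ^ n}" using X W by blast
  ultimately have "real (card (edges_in k m \<phi> X)) < 2 powr y" using \<phi> unfolding sparse_tuples_def by blast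
  then show "real (card (edges_in k m \<phi> X)) \<le> 2 powr y" by simp
qed

text \<open>Rounding \<open>y\<close> down to a multiple of \<open>k\<close> loses less than
  \<open>k\<close>, hence at most a factor of \<open>2\<close> once that multiple is
  positive.\<close>

lemma block_size:
  assumes "0 < k" "real k \<le> y"
  obtains s :: nat where "real (k * s) \<le> y" "y \<le> 2 * real k * real s"
proof
  define z where "z = nat \<lfloor>y\<rfloor>"
  have z: "real z \<le> y" "y < real z + 1" "k \<le> z"
    using assms by (simp_all add: z_def le_nat_floor)
  show "real (k * (z div k)) \<le> y"
    using z(1) times_div_less_eq_dividend[of k z] by (meson of_nat_mono order_trans)
  have "z < k * (z div k) + k"
    using assms(1) dividend_less_div_times[of k z] by (simp add: algebra_simps)
  moreover have "1 \<le> z div k" using z(3) assms(1) by (simp add: Suc_leI div_greater_zero_iff)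
  then have "k \<le> k * (z div k)" by simp
  ultimately have "z + 1 \<le> k * (z div k) + k * (z div k)" by linarith
  then have "real (z + 1) \<le> real (k * (z div k) + k * (z div k))" by (simp only: of_nat_le_iff)
  then have "real z + 1 \<le> 2 * real k * real (z div k)" by simp
  then show "y \<le> 2 * real k * real (z div k)" using z by linarith
qed

text \<open>Crude, but enough to move a constant factor into an exponent.\<close>

lemma of_nat_le_two_powr: "real j \<le> 2 powr real j"
  using of_nat_less_two_power[of j, where 'a=real] by (simp add: powr_realpow less_imp_le)

lemma of_nat_less_two_powr: "j < 2 ^ i \<Longrightarrow> real j < 2 powr real i"
  by (simp add: powr_realpow)

lemma eventually_powr_large:
  assumes "0 < \<beta>"
  obtains n0 :: nat where "\<And>n. n0 \<le> n \<Longrightarrow> real k \<le> 2 powr (\<beta> * real n - d)"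
proof -
  obtain n0 where n0: "(real k + d) / \<beta> < real n0" using reals_Archimedean2 by blast
  have "real k \<le> 2 powr (\<beta> * real n - d)" if "n0 \<le> n" for n
  proof -
    have "(real k + d) / \<beta> < real n" using n0 that by linarith
    then have "real k \<le> \<beta> * real n - d" using assms by (simp add: field_simps)
    then have "2 powr real k \<le> 2 powr (\<beta> * real n - d)" by simp
    then show ?thesis using of_nat_le_two_powr[of k] by linarith
  qed
  then show ?thesis by (rule that)
qed

lemma sparse_tuples_shift:
  assumes "0 < k" "0 < \<beta>" "0 \<le> \<alpha>"
  obtains d' :: nat where "\<And>n \<phi>. sparse_tuples k n (f n) (\<beta> * real n - real d) (\<alpha> * real (f n) + real d) \<phi> \<Longrightarrow>
      sparse_tuples k n (f n) (\<beta> * real n) (\<alpha> * real (f n) + real d') \<phi>"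
proof -
  obtain n0 where n0: "\<And>n. n0 \<le> n \<Longrightarrow> real k \<le> 2 powr (\<beta> * real n - real d)"
    using eventually_powr_large[OF assms(2)] by metis
  \<comment> \<open>The block count \<open>M\<close> has a factor \<open>2 ^ d\<close> for raising
    the size threshold and a factor \<open>2 * k\<close> for rounding to blocks. In
    \<open>d'\<close> the term \<open>M ^ k\<close> absorbs the number of block patterns,
    \<open>1\<close> makes the inequality strict, and \<open>F\<close> bounds \<open>f n\<close> for
    the finitely many \<open>n\<close> whose threshold may be too small for a block.\<close>
  define F where "F = (\<Sum>n<n0. f n)"
  define M where "M = 2 ^ d * 2 * k"
  define d' where "d' = d + M ^ k + 1 + F"
  have "sparse_tuples k n (f n) (\<beta> * real n) (\<alpha> * real (f n) + real d') \<phi>"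
    if \<phi>: "sparse_tuples k n (f n) (\<beta> * real n - real d) (\<alpha> * real (f n) + real d) \<phi>" for n \<phi>
  proof -
    have "real (card (edges_in k (f n) \<phi> W)) < 2 powr (\<alpha> * real (f n) + real d')"
      if W: "W \<subseteq> {..<2 ^ n}" "real (card W) \<le> 2 powr (\<beta> * real n)" for W
    proof (cases "n0 \<le> n")
      case True
      then obtain s where s: "real (k * s) \<le> 2 powr (\<beta> * real n - real d)"
          "2 powr (\<beta> * real n - real d) \<le> 2 * real k * real s"
        using block_size[OF assms(1) n0] by blast
      have "real (card W) \<le> 2 ^ d * 2 powr (\<beta> * real n - real d)"
        using W(2) by (simp add: powr_diff powr_realpow)
      also have "\<dots> \<le> 2 ^ d * (2 * real k * real s)" using s(2) by (intro mult_left_mono) auto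
      also have "\<dots> = real (M * s)" by (simp add: M_def)
      finally have "card W \<le> M * s" by linarith
      from sparse_tuples_blocks[OF \<phi> W(1) this s(1)]
      have "real (card (edges_in k (f n) \<phi> W)) \<le> real (M ^ k) * 2 powr (\<alpha> * real (f n) + real d)" .
      also have "\<dots> \<le> 2 powr real (M ^ k) * 2 powr (\<alpha> * real (f n) + real d)"
        by (intro mult_right_mono of_nat_le_two_powr) simp
      also have "\<dots> < 2 powr (\<alpha> * real (f n) + real d')"
        by (simp add: d'_def flip: powr_add)
      finally show ?thesis .
    next
      case False
      then have "f n \<le> F" unfolding F_def by (intro member_le_sum) auto
      have "real (card (edges_in k (f n) \<phi> W)) \<le> 2 ^ f n"
        using card_edges_in_le[of k "f n" \<phi> W] by (metis of_nat_le_iff of_nat_numeral of_nat_power)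
      also have "\<dots> = 2 powr real (f n)" by (simp add: powr_realpow)
      also have "\<dots> < 2 powr (\<alpha> * real (f n) + real d')"
      proof -
        have "f n < d'" using \<open>f n \<le> F\<close> by (simp add: d'_def)
        moreover have "0 \<le> \<alpha> * real (f n)" using assms(3) by simp
        ultimately show ?thesis by simp
      qed
      finally show ?thesis .
    qed
    then show ?thesis using \<phi> unfolding sparse_tuples_def by blast
  qed
  then show ?thesis by (rule that)
qed

text \<open>About \<open>2 powr ((1 - \<beta>) * n)\<close> blocks cover the whole vertex set. Each
  of the resulting \<open>2 powr (k * (1 - \<beta>) * n + O(1))\<close> patterns contains at most
  \<open>2 powr (\<alpha> * f n + d)\<close> edges, so
  \<open>(1 - \<alpha>) * f n \<le> k * (1 - \<beta>) * n + O(1)\<close>, and \<open>large\<close>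
  turns this into slope \<beta> / \<alpha>.\<close>

lemma sparse_tuples_size_bound:
  assumes k: "0 < k" and \<beta>: "0 < \<beta>" "\<beta> \<le> 1" and \<alpha>: "0 < \<alpha>" "\<alpha> < 1"
    and large: "real k * (1 - \<beta>) \<le> (1 - \<alpha>) * (\<beta> / \<alpha>)"
    and \<phi>: "\<And>n. k \<le> 2 ^ n \<Longrightarrow> \<exists>\<phi>. sparse_tuples k n (f n) (\<beta> * real n) (\<alpha> * real (f n) + real d) \<phi>"
  obtains c :: nat where "\<And>n. k \<le> 2 ^ n \<Longrightarrow> real (f n) \<le> \<beta> / \<alpha> * real n + real c"
proof -
  obtain n0 where n0: "\<And>n. n0 \<le> n \<Longrightarrow> real k \<le> 2 powr (\<beta> * real n - 0)"
    using eventually_powr_large[OF \<beta>(1)] by metis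
  define F where "F = (\<Sum>n<n0. f n)"
  define c where "c = nat \<lceil>real ((4 * k) ^ k + d) / (1 - \<alpha>)\<rceil> + F"
  have "real (f n) \<le> \<beta> / \<alpha> * real n + real c" if kn: "k \<le> 2 ^ n" for n
  proof (cases "n0 \<le> n")
    case True
    then obtain s where s: "real (k * s) \<le> 2 powr (\<beta> * real n)"
        "2 powr (\<beta> * real n) \<le> 2 * real k * real s"
      using block_size[OF k n0] by (metis diff_zero)
    obtain \<phi> where \<phi>: "sparse_tuples k n (f n) (\<beta> * real n) (\<alpha> * real (f n) + real d) \<phi>"
      using \<phi>[OF kn] by blast
    define z where "z = 2 powr ((1 - \<beta>) * real n)"
    have z: "1 \<le> z" using \<beta> by (simp add: z_def ge_one_powr_ge_zero)
    define M where "M = nat \<lceil>z * (2 * real k)\<rceil>"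
    have M: "z * (2 * real k) \<le> real M" "real M \<le> z * (4 * real k)"
    proof -
      show "z * (2 * real k) \<le> real M" unfolding M_def by linarith
      have "1 * 1 \<le> z * (2 * real k)" using z k by (intro mult_mono) auto
      then show "real M \<le> z * (4 * real k)" unfolding M_def by linarith
    qed
    have "real (card {..<2 ^ n :: nat}) = z * 2 powr (\<beta> * real n)"
      by (simp add: z_def powr_realpow[symmetric] powr_add[symmetric] algebra_simps)
    also have "\<dots> \<le> z * (2 * real k * real s)" using s(2) z by (intro mult_left_mono) auto
    also have "\<dots> = z * (2 * real k) * real s" by simp
    also have "\<dots> \<le> real M * real s" using M(1) by (intro mult_right_mono) auto
    finally have card: "card {..<2 ^ n :: nat} \<le> M * s" by (metis of_nat_le_iff of_nat_mult)
    have "{..<2 ^ f n} \<subseteq> edges_in k (f n) \<phi> {..<2 ^ n}"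
      using \<phi> by (auto simp: edges_in_def sparse_tuples_def)
    from card_mono[OF finite_edges_in this]
    have "2 ^ f n \<le> real (card (edges_in k (f n) \<phi> {..<2 ^ n}))"
      by (metis card_lessThan of_nat_le_iff of_nat_numeral of_nat_power)
    also have "\<dots> \<le> real (M ^ k) * 2 powr (\<alpha> * real (f n) + real d)"
      by (rule sparse_tuples_blocks[OF \<phi> subset_refl card s(1)])
    also have "\<dots> \<le> (z * (4 * real k)) ^ k * 2 powr (\<alpha> * real (f n) + real d)"
      using M(2) by (intro mult_right_mono) (auto intro: power_mono)
    also have "(z * (4 * real k)) ^ k = 2 powr (real k * (1 - \<beta>) * real n) * real ((4 * k) ^ k)"
      by (simp add: z_def power_mult_distrib powr_power mult_ac)
    also have "\<dots> \<le> 2 powr (real k * (1 - \<beta>) * real n) * 2 powr real ((4 * k) ^ k)"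
      by (intro mult_left_mono of_nat_le_two_powr) simp
    finally have "2 powr real (f n) \<le> 2 powr (real k * (1 - \<beta>) * real n + real ((4 * k) ^ k) + (\<alpha> * real (f n) + real d))"
      by (simp add: powr_realpow powr_add mult_right_mono)
    then have "(1 - \<alpha>) * real (f n) \<le> real k * (1 - \<beta>) * real n + real ((4 * k) ^ k + d)"
      by (simp add: algebra_simps)
    also have "\<dots> \<le> (1 - \<alpha>) * (\<beta> / \<alpha>) * real n + real ((4 * k) ^ k + d)"
      using large by (intro add_right_mono mult_right_mono) auto
    also have "\<dots> = (1 - \<alpha>) * (\<beta> / \<alpha> * real n + real ((4 * k) ^ k + d) / (1 - \<alpha>))"
      using \<alpha> by (simp add: field_simps)
    finally have "real (f n) \<le> \<beta> / \<alpha> * real n + real ((4 * k) ^ k + d) / (1 - \<alpha>)"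
      using \<alpha> by (metis diff_gt_0_iff_gt mult_le_cancel_left_pos)
    moreover have "real ((4 * k) ^ k + d) / (1 - \<alpha>) \<le> real c" unfolding c_def by linarith
    ultimately show ?thesis by linarith
  next
    case False
    then have "f n \<le> F" unfolding F_def by (intro member_le_sum) auto
    then have "real (f n) \<le> real c" by (simp add: c_def)
    moreover have "0 \<le> \<beta> / \<alpha> * real n" using \<alpha> \<beta> by simp
    ultimately show ?thesis by linarith
  qed
  then show ?thesis by (rule that)
qed

text \<open>Reducing edge numbers modulo \<open>2 ^ m\<close> drops edges or repeats each at most
  \<open>2 ^ c\<close> times, which adds \<open>c\<close> to the exponent; replacing \<alpha>
  \<open>m\<close> by \<alpha> \<open>m'\<close> adds at most another \<open>c\<close>.\<close>

lemma sparse_tuples_resize: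
  assumes \<phi>: "sparse_tuples k n m x (\<alpha> * real m + real d) \<phi>"
    and m: "m' \<le> m + c" "m \<le> m' + c" and \<alpha>: "0 \<le> \<alpha>" "\<alpha> \<le> 1"
  shows "sparse_tuples k n m' x (\<alpha> * real m' + real (d + 2 * c)) (\<lambda>e. \<phi> (e mod 2 ^ m))"
proof -
  let ?\<psi> = "\<lambda>e. \<phi> (e mod 2 ^ m)"
  have "real (card (edges_in k m' ?\<psi> W)) < 2 powr (\<alpha> * real m' + real (d + 2 * c))"
    if W: "W \<subseteq> {..<2 ^ n}" "real (card W) \<le> 2 powr x" for W
  proof -
    have "card (edges_in k m' ?\<psi> W) \<le> card ({..<2 ^ c :: nat} \<times> edges_in k m \<phi> W)"
    proof (rule card_inj_on_le)
      show "inj_on (\<lambda>e. (e div 2 ^ m, e mod 2 ^ m)) (edges_in k m' ?\<psi> W)"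
        by (rule inj_onI) (metis Pair_inject div_mult_mod_eq)
      have "e div 2 ^ m < 2 ^ c" if "e < 2 ^ m'" for e :: nat
      proof -
        have "(2::nat) ^ m' \<le> 2 ^ c * 2 ^ m"
          using m(1) by (simp add: power_add[symmetric] add.commute)
        then show ?thesis using that by (intro less_mult_imp_div_less) linarith
      qed
      then show "(\<lambda>e. (e div 2 ^ m, e mod 2 ^ m)) ` edges_in k m' ?\<psi> W \<subseteq> {..<2 ^ c} \<times> edges_in k m \<phi> W"
        by (auto simp: edges_in_def)
    qed (simp add: finite_edges_in)
    then have "real (card (edges_in k m' ?\<psi> W)) \<le> real (2 ^ c * card (edges_in k m \<phi> W))"
      by (simp only: card_cartesian_product card_lessThan of_nat_le_iff)
    also have "\<dots> = 2 powr real c * real (card (edges_in k m \<phi> W))" by (simp add: powr_realpow)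
    also have "\<dots> < 2 powr real c * 2 powr (\<alpha> * real m + real d)"
      using \<phi> W by (intro mult_strict_left_mono) (auto simp: sparse_tuples_def)
    also have "\<dots> \<le> 2 powr (\<alpha> * real m' + real (d + 2 * c))"
    proof -
      have "\<alpha> * real m \<le> \<alpha> * (real m' + real c)" using m(2) \<alpha> by (intro mult_left_mono) auto
      also have "\<dots> \<le> \<alpha> * real m' + real c" using \<alpha> by (simp add: algebra_simps mult_left_le_one_le)
      finally show ?thesis by (simp flip: powr_add)
    qed
    finally show ?thesis .
  qed
  moreover have "?\<psi> e i < 2 ^ n" if "i < k" for e i
    using \<phi> that by (simp add: sparse_tuples_def)
  ultimately show ?thesis unfolding sparse_tuples_def by blast
qed

section \<open>Random systems of tuples\<close>

text \<open>
  Counting: among all maps from edges to \<open>k\<close>-tuples, those for which some \<open>s\<close> vertices span some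
  \<open>t\<close> edges are fewer than all of them.
\<close>

lemma sparse_tuples_counting:
  fixes k n m s t :: nat
  assumes s: "s \<le> 2 ^ n" and t: "t \<le> 2 ^ m"
    and count: "(2 ^ n) ^ s * (2 ^ m choose t) * (s ^ k) ^ t < ((2 ^ n) ^ k) ^ t"
  shows "\<exists>\<phi>. (\<forall>e<2 ^ m. \<forall>i<k. \<phi> e i < 2 ^ n) \<and>
    (\<forall>W\<subseteq>{..<2 ^ n}. card W \<le> s \<longrightarrow> card (edges_in k m \<phi> W) < t)"
proof -
  define N :: nat where "N = 2 ^ n"
  define M :: nat where "M = 2 ^ m"
  define \<Phi> where "\<Phi> = {..<M} \<rightarrow>\<^sub>E ({..<k} \<rightarrow>\<^sub>E {..<N})"
  define \<W> where "\<W> = {W. W \<subseteq> {..<N} \<and> card W = s}"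
  define \<S> where "\<S> = {S. S \<subseteq> {..<M} \<and> card S = t}"
  \<comment> \<open>The union bound runs over these sets: the maps sending every edge of
    \<open>S\<close> into \<open>W\<close>. Exact sizes \<open>s\<close> and \<open>t\<close>
    suffice, since a smaller vertex set can be enlarged and a larger set of edges cut down.\<close>
  define Bad where "Bad W S = (\<Pi>\<^sub>E e\<in>{..<M}. if e \<in> S then {..<k} \<rightarrow>\<^sub>E W else {..<k} \<rightarrow>\<^sub>E {..<N})" for W S
  have card_Phi: "finite \<Phi>" "card \<Phi> = (N ^ k) ^ M"
    by (simp_all add: \<Phi>_def finite_PiE card_PiE)
  have fin: "finite \<W>" "finite \<S>" by (simp_all add: \<W>_def \<S>_def)
  have card_W: "card \<W> \<le> N ^ s"
    using n_subsets[of "{..<N}" s] binomial_le_pow[of s N] s by (simp add: \<W>_def N_def)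
  have card_S: "card \<S> = M choose t" using n_subsets[of "{..<M}" t] by (simp add: \<S>_def)
  have card_Bad: "card (Bad W S) = (s ^ k) ^ t * (N ^ k) ^ (M - t)" and fin_Bad: "finite (Bad W S)"
    if "W \<in> \<W>" "S \<in> \<S>" for W S
  proof -
    have WS: "W \<subseteq> {..<N}" "card W = s" "S \<subseteq> {..<M}" "card S = t" "finite S"
      using that finite_subset[of S "{..<M}"] by (auto simp: \<W>_def \<S>_def)
    show "finite (Bad W S)" unfolding Bad_def
      using finite_subset[OF WS(1)] by (auto intro!: finite_PiE)
    have "card (Bad W S) = (\<Prod>e<M. if e \<in> S then s ^ k else N ^ k)"
      unfolding Bad_def by (subst card_PiE) (auto simp: card_PiE WS intro!: prod.cong)
    also have "\<dots> = (\<Prod>e\<in>{..<M} \<inter> S. s ^ k) * (\<Prod>e\<in>{..<M} - S. N ^ k)"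
      by (subst prod.If_cases) (auto simp: Diff_eq)
    also have "{..<M} \<inter> S = S" using WS by blast
    finally show "card (Bad W S) = (s ^ k) ^ t * (N ^ k) ^ (M - t)"
      using WS by (simp add: card_Diff_subset)
  qed
  have "card (\<Union>(W, S)\<in>\<W> \<times> \<S>. Bad W S) \<le> (\<Sum>(W, S)\<in>\<W> \<times> \<S>. card (Bad W S))"
    using card_UN_le[of "\<W> \<times> \<S>" "\<lambda>(W, S). Bad W S"] fin by (simp add: case_prod_beta)
  also have "\<dots> = (\<Sum>(W, S)\<in>\<W> \<times> \<S>. (s ^ k) ^ t * (N ^ k) ^ (M - t))"
    by (rule sum.cong) (auto simp: card_Bad)
  also have "\<dots> = card \<W> * (M choose t) * ((s ^ k) ^ t * (N ^ k) ^ (M - t))"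
    by (simp add: case_prod_beta card_cartesian_product card_S)
  also have "\<dots> \<le> N ^ s * (M choose t) * ((s ^ k) ^ t * (N ^ k) ^ (M - t))"
    by (intro mult_right_mono card_W) auto
  also have "\<dots> = (N ^ s * (M choose t) * (s ^ k) ^ t) * (N ^ k) ^ (M - t)" by simp
  also have "\<dots> < (N ^ k) ^ t * (N ^ k) ^ (M - t)"
    using count by (intro mult_strict_right_mono) (auto simp: N_def M_def)
  also have "\<dots> = card \<Phi>" using t by (simp add: card_Phi M_def flip: power_add)
  finally have less: "card (\<Union>(W, S)\<in>\<W> \<times> \<S>. Bad W S) < card \<Phi>" .
  have "finite (\<Union>(W, S)\<in>\<W> \<times> \<S>. Bad W S)" using fin fin_Bad by auto
  then obtain \<phi> where \<phi>: "\<phi> \<in> \<Phi>" "\<phi> \<notin> (\<Union>(W, S)\<in>\<W> \<times> \<S>. Bad W S)"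
    using less by (meson card_mono not_less subsetI)
  have "card (edges_in k m \<phi> W) < t" if W: "W \<subseteq> {..<2 ^ n}" "card W \<le> s" for W
  proof (rule ccontr)
    assume "\<not> card (edges_in k m \<phi> W) < t"
    then obtain S where S: "S \<subseteq> edges_in k m \<phi> W" "card S = t"
      by (meson not_less obtain_subset_with_card_n)
    obtain X where X: "W \<subseteq> X" "X \<subseteq> {..<2 ^ n}" "card X = s"
      using exists_subset_between[OF W(2) _ W(1)] s by auto
    have "S \<in> \<S>" "X \<in> \<W>" using S X by (auto simp: \<S>_def \<W>_def N_def M_def edges_in_def)
    moreover have "\<phi> \<in> Bad X S"
    proof -
      have "\<phi> e \<in> {..<k} \<rightarrow>\<^sub>E X" if "e \<in> S" for e
      proof -
        have e: "e \<in> edges_in k m \<phi> W" using S that by blast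
        then have "\<phi> e \<in> {..<k} \<rightarrow>\<^sub>E {..<N}" using \<phi>(1) by (auto simp: \<Phi>_def M_def edges_in_def)
        then show ?thesis using e X(1) by (auto simp: edges_in_def PiE_def Pi_def)
      qed
      then show ?thesis using \<phi>(1) by (auto simp: Bad_def \<Phi>_def PiE_def Pi_def)
    qed
    ultimately show False using \<phi>(2) by blast
  qed
  moreover have "\<phi> e i < 2 ^ n" if "e < 2 ^ m" "i < k" for e i
    using \<phi>(1) that unfolding \<Phi>_def N_def M_def by blast
  ultimately show ?thesis by blast
qed

text \<open>The usual bound with Euler's number in place of \<open>4\<close>, rounded up:
  \<open>t ^ t / fact t\<close> is a single term of the series of \<open>exp t\<close>.\<close>

lemma binomial_le_power:
  assumes "0 < t"
  shows "real (2 ^ m choose t) \<le> (4 * 2 ^ m / real t) ^ t"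
proof -
  have "(real t) ^ t / fact t \<le> exp (real t)"
  proof -
    have "(\<Sum>i\<in>{t}. real t ^ i /\<^sub>R fact i) \<le> exp (real t)"
      unfolding exp_def by (rule sum_le_suminf) (auto intro: summable_exp)
    then show ?thesis by (simp add: field_simps)
  qed
  also have "\<dots> = exp 1 ^ t" by (simp add: exp_of_nat_mult[symmetric])
  also have "\<dots> \<le> 4 ^ t" using exp_le by (intro power_mono) auto
  finally have fact: "real t ^ t \<le> 4 ^ t * fact t" by (simp add: field_simps)
  have "real (2 ^ m choose t) * fact t \<le> (2 ^ m) ^ t"
    using of_nat_mono[OF binomial_fact_pow[of "2 ^ m" t], where 'a=real] by simp
  then have "real (2 ^ m choose t) * real t ^ t \<le> real (2 ^ m choose t) * (4 ^ t * fact t)"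
    using fact by (intro mult_left_mono) auto
  also have "\<dots> = 4 ^ t * (real (2 ^ m choose t) * fact t)" by simp
  also have "\<dots> \<le> 4 ^ t * (2 ^ m) ^ t"
    using \<open>real (2 ^ m choose t) * fact t \<le> (2 ^ m) ^ t\<close> by (intro mult_left_mono) auto
  finally show ?thesis using assms by (simp add: power_divide power_mult_distrib field_simps)
qed

text \<open>In exponents, choosing \<open>W\<close> costs \<open>n * s\<close>, choosing the
  \<open>t\<close> edges costs \<open>t * w\<close> with \<open>w\<close> close to
  \<open>(1 - \<alpha>) * m\<close>, and all of them falling into \<open>W\<close> gains
  \<open>t * k * (1 - \<beta>) * n\<close>. As \<open>m\<close> is about \<beta> / \<alpha> times
  \<open>n\<close>, the net gain per edge is at least \<open>\<delta> * n + 1\<close>, which pays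
  for \<open>W\<close> because \<open>t * \<delta>\<close> exceeds \<open>s\<close>.\<close>

lemma sparse_tuples_random:
  assumes \<beta>: "0 < \<beta>" "\<beta> \<le> 1" and \<alpha>: "0 < \<alpha>" "\<alpha> < 1"
    and small: "(1 - \<alpha>) * (\<beta> / \<alpha>) < real k * (1 - \<beta>)"
    and f: "\<And>n. \<bar>real (f n) - \<beta> / \<alpha> * real n\<bar> \<le> real c"
  shows "\<exists>d::nat. \<forall>n. \<exists>\<phi>. sparse_tuples k n (f n) (\<beta> * real n) (\<alpha> * real (f n) + real d) \<phi>"
proof -
  define \<delta> where "\<delta> = real k * (1 - \<beta>) - (1 - \<alpha>) * (\<beta> / \<alpha>)"
  have \<delta>: "0 < \<delta>" using small by (simp add: \<delta>_def)
  define j where "j = nat \<lceil>1 / \<delta>\<rceil>"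
  have j: "1 \<le> 2 powr real j * \<delta>"
  proof -
    have "1 / \<delta> \<le> real j" unfolding j_def by linarith
    also have "\<dots> \<le> 2 powr real j" by (rule of_nat_le_two_powr)
    finally show ?thesis using \<delta> by (simp add: field_simps)
  qed
  \<comment> \<open>Here \<open>c\<close> compensates the deviation of \<open>f\<close> from the
    line, \<open>j\<close> makes \<open>t\<close> exceed \<open>s\<close> by a factor of at least
    \<open>1 / \<delta>\<close>, and \<open>3\<close> covers the factor \<open>4\<close> of the
    binomial bound and strictness.\<close>
  define d where "d = c + j + 3"
  have "\<exists>\<phi>. sparse_tuples k n (f n) (\<beta> * real n) (\<alpha> * real (f n) + real d) \<phi>" for n
  proof -
    define m where "m = f n"
    define y where "y = 2 powr (\<alpha> * real m + real d)"
    define t where "t = nat \<lceil>y\<rceil>"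
    define s where "s = nat \<lfloor>2 powr (\<beta> * real n)\<rfloor>"
    have y: "0 < y" by (simp add: y_def)
    have t: "y \<le> real t" "0 < t" "\<And>i. i < t \<Longrightarrow> real i < y"
      using y unfolding t_def by linarith+
    have s: "real s \<le> 2 powr (\<beta> * real n)" unfolding s_def by simp
    have s': "i \<le> s" if "real i \<le> 2 powr (\<beta> * real n)" for i
      using that unfolding s_def by (simp add: le_nat_floor)
    have "\<exists>\<phi>. (\<forall>e<2 ^ m. \<forall>i<k. \<phi> e i < 2 ^ n) \<and>
      (\<forall>W\<subseteq>{..<2 ^ n}. card W \<le> s \<longrightarrow> card (edges_in k m \<phi> W) < t)"
    proof (cases "t \<le> 2 ^ m")
      case False
      then have "card (edges_in k m \<phi> W) < t" for \<phi> W using card_edges_in_le[of k m \<phi> W] by linarith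
      then show ?thesis by (intro exI[of _ "\<lambda>_ _. 0"]) simp
    next
      case True
      have "real s \<le> 2 powr real n"
        using s by (rule order_trans) (use \<beta> in \<open>simp add: mult_left_le_one_le\<close>)
      then have sn: "s \<le> 2 ^ n" by (simp add: powr_realpow)
      have \<alpha>m: "\<beta> * real n - real c \<le> \<alpha> * real m"
      proof -
        have "\<alpha> * (\<beta> / \<alpha> * real n - real c) \<le> \<alpha> * real m"
          using f[of n] \<alpha> unfolding m_def by (intro mult_left_mono) auto
        moreover have "\<alpha> * (\<beta> / \<alpha> * real n - real c) = \<beta> * real n - \<alpha> * real c"
          using \<alpha> by (simp add: field_simps)
        moreover have "\<alpha> * real c \<le> real c" using \<alpha> by (simp add: mult_left_le_one_le)
        ultimately show ?thesis by linarith
      qed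
      have m_upper: "(1 - \<alpha>) * real m \<le> (1 - \<alpha>) * (\<beta> / \<alpha>) * real n + real c"
      proof -
        have "(1 - \<alpha>) * real m \<le> (1 - \<alpha>) * (\<beta> / \<alpha> * real n + real c)"
          using f[of n] \<alpha> unfolding m_def by (intro mult_left_mono) auto
        moreover have "(1 - \<alpha>) * real c \<le> real c" using \<alpha> by (simp add: mult_left_le_one_le)
        ultimately show ?thesis by (simp add: algebra_simps)
      qed
      define w where "w = 2 + (1 - \<alpha>) * real m - real d"
      have "real n * 2 powr (\<beta> * real n) \<le> real n * (2 powr (\<beta> * real n) * (2 powr real j * \<delta>))"
        using j by (intro mult_left_mono) (auto simp: mult_le_cancel_left1)
      also have "\<dots> = 2 powr (\<beta> * real n + real j) * (\<delta> * real n)" by (simp add: powr_add)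
      also have "\<dots> \<le> y * (\<delta> * real n)"
        unfolding y_def d_def using \<alpha>m \<delta> by (intro mult_right_mono) auto
      also have "\<dots> < y * (\<delta> * real n + 1)" using y by simp
      also have "\<dots> \<le> real t * (\<delta> * real n + 1)" using t(1) \<delta> by (intro mult_right_mono) auto
      also have "\<dots> \<le> real t * (real k * (1 - \<beta>) * real n - w)"
        using m_upper unfolding w_def \<delta>_def d_def by (intro mult_left_mono) (auto simp: algebra_simps)
      finally have key: "real n * 2 powr (\<beta> * real n) + real t * w + real t * (real k * (\<beta> * real n))
          < real t * (real k * real n)"
        by (simp add: algebra_simps)
      have "real ((2 ^ n) ^ s) = 2 powr (real n * real s)"
        by (simp add: powr_realpow[symmetric] powr_powr)
      also have "\<dots> \<le> 2 powr (real n * 2 powr (\<beta> * real n))"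
        using s by (simp add: mult_left_mono)
      finally have b1: "real ((2 ^ n) ^ s) \<le> 2 powr (real n * 2 powr (\<beta> * real n))" .
      have "real (2 ^ m choose t) \<le> (4 * 2 ^ m / real t) ^ t" by (rule binomial_le_power[OF t(2)])
      also have "\<dots> \<le> (2 powr w) ^ t"
      proof (rule power_mono)
        have "4 * 2 ^ m / real t \<le> 4 * 2 ^ m / y" using t y by (intro divide_left_mono) auto
        also have "\<dots> = 2 powr w"
          by (simp add: w_def y_def powr_add powr_diff powr_realpow[symmetric] algebra_simps)
        finally show "4 * 2 ^ m / real t \<le> 2 powr w" .
      qed simp
      also have "\<dots> = 2 powr (real t * w)" by (simp add: powr_power mult.commute)
      finally have b2: "real (2 ^ m choose t) \<le> 2 powr (real t * w)" .
      have "real ((s ^ k) ^ t) \<le> ((2 powr (\<beta> * real n)) ^ k) ^ t"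
        using s by (auto intro!: power_mono)
      also have "\<dots> = 2 powr (real t * (real k * (\<beta> * real n)))" by (simp add: powr_power mult_ac)
      finally have b3: "real ((s ^ k) ^ t) \<le> 2 powr (real t * (real k * (\<beta> * real n)))" .
      have "real ((2 ^ n) ^ s * (2 ^ m choose t) * (s ^ k) ^ t) \<le>
          2 powr (real n * 2 powr (\<beta> * real n)) * 2 powr (real t * w) * 2 powr (real t * (real k * (\<beta> * real n)))"
        unfolding of_nat_mult using b1 b2 b3 by (intro mult_mono) auto
      also have "\<dots> < 2 powr (real t * (real k * real n))"
        using key by (simp flip: powr_add)
      also have "\<dots> = real (((2 ^ n) ^ k) ^ t)"
        by (simp add: powr_realpow[symmetric] powr_powr mult_ac)
      finally have "(2 ^ n) ^ s * (2 ^ m choose t) * (s ^ k) ^ t < ((2 ^ n) ^ k) ^ t"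
        by (simp only: of_nat_less_iff)
      from sparse_tuples_counting[OF sn True this] show ?thesis .
    qed
    then obtain \<phi> where \<phi>: "\<And>e i. e < 2 ^ m \<Longrightarrow> i < k \<Longrightarrow> \<phi> e i < 2 ^ n"
      "\<And>W. W \<subseteq> {..<2 ^ n} \<Longrightarrow> card W \<le> s \<Longrightarrow> card (edges_in k m \<phi> W) < t" by blast
    have "sparse_tuples k n m (\<beta> * real n) (\<alpha> * real m + real d) \<phi>"
      unfolding sparse_tuples_def y_def[symmetric] using \<phi> s' t(3) by simp
    then show ?thesis unfolding m_def by blast
  qed
  then show ?thesis by blast
qed

section \<open>From extraction to hypergraphs\<close>

lemma set_encode_less:
  assumes "W \<subseteq> {..<N}"
  shows "set_encode W < 2 ^ N"
proof -
  have "set_encode W \<le> (\<Sum>i<N. 2 ^ i)" unfolding set_encode_def using assms by (intro sum_mono2) auto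
  also have "\<dots> < 2 ^ N" using sum_power2[of N] by (simp add: atLeast0LessThan)
  finally show ?thesis .
qed

context optimal_function
begin

text \<open>One machine for each \<open>i\<close>, with the constants added up. The index stands for
  a remainder of \<open>approx_inverse\<close>, for the number of an extractor, or for both.\<close>

lemma K_decidable_family_finite:
  assumes "finite I" "\<And>i. i \<in> I \<Longrightarrow> decidable3 (Q i)" "\<And>i. i \<in> I \<Longrightarrow> computable3 (out i)"
  obtains c where "\<And>i e t z. i \<in> I \<Longrightarrow> Q i e t z \<Longrightarrow> finite {z. Q i e t z} \<Longrightarrow>
    card {z. Q i e t z} \<le> 2 ^ t \<Longrightarrow> K (out i e t z) \<le> t + e + c"
proof -
  have "\<exists>c. \<forall>e t z. Q i e t z \<longrightarrow> finite {z. Q i e t z} \<longrightarrow> card {z. Q i e t z} \<le> 2 ^ t \<longrightarrow>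
    K (out i e t z) \<le> t + e + c" if "i \<in> I" for i
    using that assms by (intro K_decidable_family) auto
  then obtain c where c: "\<And>i e t z. i \<in> I \<Longrightarrow> Q i e t z \<Longrightarrow> finite {z. Q i e t z} \<Longrightarrow>
    card {z. Q i e t z} \<le> 2 ^ t \<Longrightarrow> K (out i e t z) \<le> t + e + c i" by metis
  have "K (out i e t z) \<le> t + e + sum c I"
    if "i \<in> I" "Q i e t z" "finite {z. Q i e t z}" "card {z. Q i e t z} \<le> 2 ^ t" for i e t z
  proof -
    have "c i \<le> sum c I" using that assms(1) by (intro member_le_sum) auto
    then show ?thesis using c[OF that] by linarith
  qed
  then show ?thesis by (rule that)
qed

text \<open>The witness has complexity at least \<open>l\<close>, and its index has only
  \<open>l\<close> bits. So its complexity is \<open>l\<close> up to a constant whenever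
  \<open>m\<close> can be computed from \<open>l\<close> with bounded advice.\<close>

lemma exists_K_ge:
  assumes "l \<le> m"
  obtains z where "z < 2 ^ l" "l \<le> K (nth_code m z)"
proof -
  have "\<not> (\<forall>z<2 ^ l. K (nth_code m z) < l)"
  proof
    assume "\<forall>z<2 ^ l. K (nth_code m z) < l"
    then have "card (nth_code m ` {..<2 ^ l}) < 2 ^ l" by (intro card_K_less) auto
    moreover have "card (nth_code m ` {..<2 ^ l}) = 2 ^ l"
      by (subst card_image) (auto simp: inj_on_def nth_code_inj)
    ultimately show False by simp
  qed
  then show ?thesis using that by (meson not_less)
qed

text \<open>The first string \<open>x t\<close> of length \<open>f (q * t)\<close> is described by
  \<open>t + O(1)\<close> bits, and so are its images, which is too little for
  \<open>\<beta> * q * t \<ge> 2 * t\<close>. Hence \<open>K (x t) < d\<close> for all large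
  \<open>t\<close>; but these strings are distinct, and fewer than \<open>2 ^ d\<close> strings are
  that simple.\<close>

lemma EXT_alpha_zero:
  fixes k d :: nat and \<gamma> :: "nat \<Rightarrow> nat \<Rightarrow> nat"
  assumes f: "computable_nat f" "inj f" and \<gamma>: "\<And>i. i \<in> {1..k} \<Longrightarrow> computable_nat (\<gamma> i)"
    and ext: "\<And>n x. code_length x = f n \<Longrightarrow> real (K x) \<ge> real d \<Longrightarrow>
      \<exists>i\<in>{1..k}. real (K (\<gamma> i x)) \<ge> \<beta> * real n - real d"
  shows "\<beta> \<le> 0"
proof (rule ccontr)
  assume "\<not> \<beta> \<le> 0"
  then have \<beta>: "0 < \<beta>" by simp
  define q where "q = nat \<lceil>2 / \<beta>\<rceil>"
  have "2 / \<beta> \<le> real q" unfolding q_def by linarith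
  then have q: "2 \<le> \<beta> * real q" using \<beta> by (simp add: field_simps)
  define x where "x t = nth_code (f (q * t)) 0" for t
  \<comment> \<open>The set is a mere singleton: the \<open>t\<close> bits serve only to convey
    \<open>t\<close> itself, which is wasteful but cheap enough.\<close>
  obtain c where c: "\<And>i e t z. i \<in> {1..k} \<Longrightarrow> z = 0 \<Longrightarrow> finite {z::nat. z = 0} \<Longrightarrow>
      card {z::nat. z = 0} \<le> 2 ^ t \<Longrightarrow> K (\<gamma> i (x t)) \<le> t + e + c"
  proof (rule K_decidable_family_finite[of "{1..k}" "\<lambda>i e t z. z = 0" "\<lambda>i e t z. \<gamma> i (x t)"])
    show "decidable3 (\<lambda>e t z. z = 0)" unfolding decidable3_def by (intro computable_rules)
    show "computable3 (\<lambda>e t z. \<gamma> i (x t))" if "i \<in> {1..k}" for i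
      unfolding computable3_def x_def
      by (intro computable_compose[OF \<gamma>[OF that]] computable_nth_code computable_compose[OF f(1)] computable_rules)
  qed (simp, rule that, blast)
  have x: "code_length (x t) = f (q * t)" for t unfolding x_def by (simp add: code_length_nth_code)
  have small: "K (x t) < d" if "c + d < t" for t
  proof (rule ccontr)
    assume "\<not> K (x t) < d"
    then have "real d \<le> real (K (x t))" by simp
    from ext[OF x this] obtain i
      where i: "i \<in> {1..k}" "real (K (\<gamma> i (x t))) \<ge> \<beta> * real (q * t) - real d" by blast
    have "K (\<gamma> i (x t)) \<le> t + 0 + c" by (rule c[OF i(1)]) auto
    then have "real (K (\<gamma> i (x t))) \<le> real t + real c" by linarith
    moreover have "2 * real t \<le> \<beta> * real q * real t" using q by (intro mult_right_mono) auto
    then have "2 * real t \<le> \<beta> * real (q * t)" by (simp add: mult.assoc)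
    moreover have "real c + real d < real t" using that by linarith
    ultimately show False using i(2) by linarith
  qed
  have "0 < q" using q by (cases q) auto
  then have "inj x"
    by (intro injI) (metis x f(2) injD mult_cancel1 not_gr_zero)
  then have "card (x ` {c + d + 1..<c + d + 1 + 2 ^ d}) = 2 ^ d"
    by (subst card_image) (auto intro: inj_on_subset)
  moreover have "card (x ` {c + d + 1..<c + d + 1 + 2 ^ d}) < 2 ^ d"
    by (rule card_K_less) (auto intro!: small)
  ultimately show False by simp
qed

text \<open>A string of length \<open>m = f n\<close> with an index of \<open>A m + 2 + d\<close>
  bits can be complex enough to trigger the extractors. All its images have complexity at most
  \<open>\<alpha> * m + O(1)\<close>, and one has at least \<open>\<beta> * n - d\<close>; comparing
  the two gives the bound.\<close>

lemma EXT_ratio_bound: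
  fixes k d :: nat and \<gamma> :: "nat \<Rightarrow> nat \<Rightarrow> nat"
  assumes f: "computable_nat f" "inj f" and \<gamma>: "\<And>i. i \<in> {1..k} \<Longrightarrow> computable_nat (\<gamma> i)"
    and ext: "\<And>n x. code_length x = f n \<Longrightarrow> real (K x) \<ge> \<alpha> * real (f n) + real d \<Longrightarrow>
      \<exists>i\<in>{1..k}. real (K (\<gamma> i x)) \<ge> \<beta> * real n - real d"
    and \<alpha>: "0 \<le> \<alpha>" "\<alpha> < 1" and \<beta>: "0 < \<beta>" "\<beta> \<le> 1"
    and A: "computable_nat A" "\<And>m. \<bar>real (A m) - \<alpha> * real m\<bar> \<le> 2"
  shows "ratio_bound \<alpha> \<beta> f"
proof (cases "\<alpha> = 0")
  case True
  have "\<beta> \<le> 0" by (rule EXT_alpha_zero[OF f, of k \<gamma> d]) (use \<gamma> ext True in auto)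
  then show ?thesis using \<beta> by simp
next
  case False
  then have \<alpha>_pos: "0 < \<alpha>" using \<alpha> by simp
  obtain g R where g: "computable_nat g" and R: "\<And>m. \<exists>r\<le>R. m = g (A m) + r"
    using approx_inverse[OF A \<alpha>_pos] \<alpha> by (metis less_imp_le)
  \<comment> \<open>At \<open>t = A m + 2 + d\<close> the expression
    \<open>g (t - (2 + d)) + r\<close> equals \<open>m\<close> for the right
    \<open>r\<close>.\<close>
  define out where "out = (\<lambda>(i, r) (e::nat) t z. \<gamma> i (nth_code (g (t - (2 + d)) + r) z))"
  obtain c where c: "\<And>p e t z. p \<in> {1..k} \<times> {..R} \<Longrightarrow> z < 2 ^ t \<Longrightarrow> finite {z::nat. z < 2 ^ t} \<Longrightarrow>
      card {z::nat. z < 2 ^ t} \<le> 2 ^ t \<Longrightarrow> K (out p e t z) \<le> t + e + c"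
  proof (rule K_decidable_family_finite[of "{1..k} \<times> {..R}" "\<lambda>p e t z. z < 2 ^ t" out])
    show "decidable3 (\<lambda>e t z. z < 2 ^ t)" unfolding decidable3_def by (intro computable_rules)
    show "computable3 (out p)" if p': "p \<in> {1..k} \<times> {..R}" for p
    proof -
      obtain i r where p: "p = (i, r)" "i \<in> {1..k}" using p' by blast
      show ?thesis unfolding computable3_def out_def p(1) prod.case
        by (intro computable_compose[OF \<gamma>[OF p(2)]] computable_nth_code computable_compose[OF g] computable_rules)
    qed
  qed (simp, rule that, blast)
  \<comment> \<open>An index of \<open>A m + 2 + d\<close> bits fits into length \<open>m\<close>
    only from \<open>m0\<close> on, where \<alpha> < 1 is needed. Injectivity of \<open>f\<close>
    leaves finitely many \<open>n\<close> with \<open>f n\<close> below it.\<close>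
  define m0 where "m0 = nat \<lceil>(4 + real d) / (1 - \<alpha>)\<rceil>"
  have m0: "A m + 2 + d \<le> m" if "m0 \<le> m" for m
  proof -
    have "(4 + real d) / (1 - \<alpha>) \<le> real m" using that unfolding m0_def by linarith
    then have "4 + real d \<le> (1 - \<alpha>) * real m" using \<alpha> by (simp add: field_simps)
    then have "real (A m) + 2 + real d \<le> real m" using A(2)[of m] by (simp add: algebra_simps)
    then show ?thesis by linarith
  qed
  have "finite (f -` {..<m0})" using f(2) by (intro finite_vimageI) auto
  then obtain n1 where n1: "\<And>n. f n < m0 \<Longrightarrow> n \<le> n1"
    unfolding finite_nat_set_iff_bounded_le by auto
  have bound: "\<beta> * real n \<le> \<alpha> * real (f n) + real (4 + 2 * d + c + n1)" for n
  proof (cases "f n < m0")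
    case True
    then have "real n \<le> real n1" using n1 by simp
    moreover have "\<beta> * real n \<le> real n" using \<beta> by (simp add: mult_left_le_one_le)
    moreover have "0 \<le> \<alpha> * real (f n)" using \<alpha> by simp
    ultimately show ?thesis by simp
  next
    case False
    define m where "m = f n"
    define l where "l = A m + 2 + d"
    have lm: "l \<le> m" using False m0 unfolding l_def m_def by simp
    obtain z where z: "z < 2 ^ l" "l \<le> K (nth_code m z)" using exists_K_ge[OF lm] by blast
    have "z < 2 ^ m" using z(1) by (rule less_le_trans) (use lm in simp)
    then have "code_length (nth_code m z) = f n" by (simp add: code_length_nth_code m_def)
    moreover have "\<alpha> * real (f n) + real d \<le> real (K (nth_code m z))"
      using z(2) A(2)[of m] unfolding l_def m_def by linarith
    ultimately obtain i where i: "i \<in> {1..k}" "real (K (\<gamma> i (nth_code m z))) \<ge> \<beta> * real n - real d"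
      using ext by blast
    obtain r where r: "r \<le> R" "m = g (A m) + r" using R by blast
    have "K (out (i, r) 0 l z) \<le> l + 0 + c" using i r z by (intro c) auto
    moreover have "out (i, r) 0 l z = \<gamma> i (nth_code m z)" using r(2) by (simp add: out_def l_def)
    ultimately have "real (K (\<gamma> i (nth_code m z))) \<le> real (A m) + 2 + real d + real c"
      unfolding l_def by simp
    then show ?thesis using i(2) A(2)[of m] unfolding m_def by simp
  qed
  have "\<beta> / \<alpha> * real n - real (4 + 2 * d + c + n1) / \<alpha> \<le> real (f n)" for n
    using bound[of n] \<alpha>_pos by (simp add: field_simps)
  then show ?thesis using ratio_bound_pos[OF \<alpha>_pos] by blast
qed

text \<open>If the search finds a bad vertex set, its elements have complexity at most
  \<open>B n - 2 * e + e + c\<close>, below the level the extractors guarantee. So every edge inside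
  has complexity below \<open>\<alpha> * f n + d\<close>, yet there are at least
  \<open>2 ^ (A (f n) + 2 * e)\<close> of them, more than there are such strings.\<close>

lemma EXT_sparse_tuples:
  fixes k d :: nat and \<gamma> :: "nat \<Rightarrow> nat \<Rightarrow> nat"
  assumes f: "computable_nat f" and k: "0 < k" and \<gamma>: "\<And>i. i \<in> {1..k} \<Longrightarrow> computable_nat (\<gamma> i)"
    and len: "\<And>n x i. code_length x = f n \<Longrightarrow> i \<in> {1..k} \<Longrightarrow> code_length (\<gamma> i x) = n"
    and ext: "\<And>n x. code_length x = f n \<Longrightarrow> real (K x) \<ge> \<alpha> * real (f n) + real d \<Longrightarrow>
      \<exists>i\<in>{1..k}. real (K (\<gamma> i x)) \<ge> \<beta> * real n - real d"
    and \<beta>: "0 < \<beta>" "\<beta> \<le> 1"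
    and A: "computable_nat A" "\<And>m. \<bar>real (A m) - \<alpha> * real m\<bar> \<le> 2"
    and B: "computable_nat B" "\<And>m. \<bar>real (B m) - \<beta> * real m\<bar> \<le> 2"
  shows "\<exists>d'::nat. \<forall>n. \<exists>\<phi>. sparse_tuples k n (f n) (\<beta> * real n - real d') (\<alpha> * real (f n) + real d') \<phi>"
proof -
  define hits where "hits n w = {x. x < 2 ^ f n \<and>
      (\<forall>i\<in>{1..k}. \<gamma> i (nth_code (f n) x) - (2 ^ n - 1) \<in> set_decode w)}" for n w
  define bad where "bad n e w \<longleftrightarrow> 2 * e \<le> B n \<and> card {v. v < 2 ^ n \<and> v \<in> set_decode w} \<le> 2 ^ (B n - 2 * e) \<and>
      2 ^ (A (f n) + 2 * e) \<le> card (hits n w)" for n e w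
  \<comment> \<open>The second disjunct makes the search total; the codes below
    \<open>2 ^ (2 ^ n)\<close> are those of the sets of vertices.\<close>
  define wit where "wit n e = (LEAST w. bad n e w \<or> 2 ^ (2 ^ n) \<le> w)" for n e
  have bad: "decidable3 bad"
    unfolding decidable3_def bad_def hits_def
    by (intro computable_rules decidable_ball_finite computable_compose[OF A(1)] computable_compose[OF B(1)]
        computable_compose[OF f(1)] computable_nth_code)
      (auto intro!: computable_rules computable_compose[OF \<gamma>] computable_nth_code computable_compose[OF f(1)])
  have wit: "computable2 wit"
    unfolding computable2_def wit_def
    by (rule computable_Least, blast) (intro computable_rules decidable3D[OF bad])
  obtain g R where g: "computable_nat g" and R: "\<And>m. \<exists>r\<le>R. m = g (B m) + r"
    using approx_inverse[OF B \<beta>] by metis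
  \<comment> \<open>At \<open>t = B n - 2 * e\<close> this equals \<open>n\<close> for the right
    \<open>r\<close>.\<close>
  define num where "num r e t = g (t + 2 * e) + r" for r e t
  define Q where "Q r e t z \<longleftrightarrow> z < 2 ^ num r e t \<and> z \<in> set_decode (wit (num r e t) e)" for r e t z
  obtain c where c: "\<And>r e t z. r \<in> {..R} \<Longrightarrow> Q r e t z \<Longrightarrow> finite {z. Q r e t z} \<Longrightarrow>
      card {z. Q r e t z} \<le> 2 ^ t \<Longrightarrow> K (nth_code (num r e t) z) \<le> t + e + c"
  proof (rule K_decidable_family_finite[of "{..R}" Q "\<lambda>r e t z. nth_code (num r e t) z"])
    show "decidable3 (Q r)" for r unfolding decidable3_def Q_def num_def
      by (intro computable_rules computable_compose[OF g] computable2D[OF wit])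
    show "computable3 (\<lambda>e t z. nth_code (num r e t) z)" for r unfolding computable3_def num_def
      by (intro computable_rules computable_compose[OF g] computable_nth_code)
  qed (simp, rule that, blast)
  \<comment> \<open>Chosen so that \<open>B n - e + c\<close> lies below
    \<open>\<beta> * n - d\<close>: the \<open>3\<close> covers the error \<open>2\<close> of
    \<open>B\<close> and strictness.\<close>
  define e where "e = d + 3 + c"
  have not_bad: "\<not> bad n e w" if w: "w < 2 ^ (2 ^ n)" for n w
  proof
    assume "bad n e w"
    then have "bad n e (wit n e) \<or> 2 ^ (2 ^ n) \<le> wit n e" unfolding wit_def by (intro LeastI) blast
    moreover have "wit n e \<le> w" unfolding wit_def using \<open>bad n e w\<close> by (intro Least_le) blast
    ultimately have W: "bad n e (wit n e)" using w by simp
    define t where "t = B n - 2 * e"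
    obtain r where r: "r \<le> R" "n = g (B n) + r" using R by blast
    have num: "num r e t = n" using r W by (simp add: num_def t_def bad_def)
    have K_small: "K (nth_code n z) + e \<le> B n + c" if z: "z < 2 ^ n" "z \<in> set_decode (wit n e)" for z
    proof -
      have Q_iff: "Q r e t y \<longleftrightarrow> y < 2 ^ n \<and> y \<in> set_decode (wit n e)" for y by (simp only: Q_def num)
      have "K (nth_code (num r e t) z) \<le> t + e + c"
      proof (rule c)
        show "card {z. Q r e t z} \<le> 2 ^ t" unfolding Q_iff using W by (simp only: bad_def t_def)
      qed (use r z in \<open>simp_all add: Q_iff\<close>)
      moreover have "2 * e \<le> B n" using W by (simp add: bad_def)
      ultimately show ?thesis unfolding num by (simp add: t_def)
    qed
    have "K (nth_code (f n) x) < A (f n) + 2 + d" if x: "x \<in> hits n (wit n e)" for x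
    proof -
      define X where "X = nth_code (f n) x"
      have X: "code_length X = f n" using x by (simp add: X_def hits_def code_length_nth_code)
      have "real (K (\<gamma> i X)) < \<beta> * real n - real d" if i: "i \<in> {1..k}" for i
      proof -
        obtain v where v: "v < 2 ^ n" "\<gamma> i X = nth_code n v"
          using code_length_cases[OF len[OF X i]] by blast
        have "\<gamma> i X - (2 ^ n - 1) = v" by (simp add: v(2) nth_code_def)
        then have "v \<in> set_decode (wit n e)" using x i unfolding hits_def X_def by blast
        from K_small[OF v(1) this] show ?thesis using B(2)[of n] by (simp add: v(2) e_def)
      qed
      then have "real (K X) < \<alpha> * real (f n) + real d" using ext[OF X] by (meson not_less)
      then have "real (K X) < real (A (f n)) + 2 + real d" using A(2)[of "f n"] by linarith
      then show ?thesis unfolding X_def by linarith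
    qed
    then have "card (nth_code (f n) ` hits n (wit n e)) < 2 ^ (A (f n) + 2 + d)"
      by (intro card_K_less) (auto simp: hits_def)
    moreover have "card (nth_code (f n) ` hits n (wit n e)) = card (hits n (wit n e))"
      by (rule card_image) (simp add: inj_on_def nth_code_inj)
    moreover have "(2::nat) ^ (A (f n) + 2 + d) \<le> 2 ^ (A (f n) + 2 * e)"
      by (intro power_increasing) (auto simp: e_def)
    ultimately show False using W unfolding bad_def by linarith
  qed
  \<comment> \<open>The \<open>2\<close> absorbs the errors of \<open>A\<close> and
    \<open>B\<close>.\<close>
  define d' where "d' = 2 * e + 2"
  have "sparse_tuples k n (f n) (\<beta> * real n - real d') (\<alpha> * real (f n) + real d')
      (\<lambda>x i. \<gamma> (Suc i) (nth_code (f n) x) - (2 ^ n - 1))" (is "sparse_tuples _ _ _ _ _ ?\<phi>") for n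
    unfolding sparse_tuples_def
  proof (intro conjI allI impI)
    fix x i :: nat assume "x < 2 ^ f n" "i < k"
    then have "code_length (\<gamma> (Suc i) (nth_code (f n) x)) = n"
      by (intro len) (auto simp: code_length_nth_code)
    then show "?\<phi> x i < 2 ^ n" unfolding code_length_eq_iff by auto
  next
    fix W :: "nat set" assume W: "W \<subseteq> {..<2 ^ n}" "real (card W) \<le> 2 powr (\<beta> * real n - real d')"
    have fin: "finite W" using W(1) finite_subset by blast
    show "real (card (edges_in k (f n) ?\<phi> W)) < 2 powr (\<alpha> * real (f n) + real d')"
    proof (cases "W = {}")
      case True
      then have "edges_in k (f n) ?\<phi> W = {}" using k by (auto simp: edges_in_def)
      then show ?thesis by simp
    next
      \<comment> \<open>A nonempty \<open>W\<close> forces the threshold to be at least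
        \<open>1\<close>, which yields the guard \<open>2 * e \<le> B n\<close> against truncated
        subtraction.\<close>
      case False
      then have "1 \<le> real (card W)" using fin by (simp add: Suc_leI card_gt_0_iff)
      then have "1 \<le> 2 powr (\<beta> * real n - real d')" using W(2) by linarith
      then have "0 \<le> \<beta> * real n - real d'"
        using powr_le_cancel_iff[of 2 0 "\<beta> * real n - real d'"] by simp
      then have eB: "2 * e \<le> B n" using B(2)[of n] unfolding d'_def by simp
      have "real (card W) \<le> 2 powr real (B n - 2 * e)"
        by (rule order_trans[OF W(2)]) (use B(2)[of n] eB in \<open>simp add: d'_def of_nat_diff\<close>)
      then have cardW: "card W \<le> 2 ^ (B n - 2 * e)" by (simp add: powr_realpow)
      define w where "w = set_encode W"
      have dec: "set_decode w = W" using fin by (simp add: w_def)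
      have "{v. v < 2 ^ n \<and> v \<in> set_decode w} = W" using W(1) by (auto simp: dec)
      moreover have "\<not> bad n e w" using W(1) by (intro not_bad) (simp add: w_def set_encode_less)
      ultimately have "card (hits n w) < 2 ^ (A (f n) + 2 * e)" using eB cardW by (auto simp: bad_def)
      moreover have "edges_in k (f n) ?\<phi> W = hits n w"
      proof -
        have "(\<forall>i<k. \<gamma> (Suc i) X - (2 ^ n - 1) \<in> W) \<longleftrightarrow> (\<forall>i\<in>{1..k}. \<gamma> i X - (2 ^ n - 1) \<in> W)" for X
          by (metis One_nat_def Suc_le_D Suc_le_eq atLeastAtMost_iff le_add1 plus_1_eq_Suc)
        then show ?thesis by (simp only: edges_in_def hits_def dec)
      qed
      ultimately have "real (card (edges_in k (f n) ?\<phi> W)) < 2 powr real (A (f n) + 2 * e)"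
        by (intro of_nat_less_two_powr) (simp only:)
      also have "\<dots> \<le> 2 powr (\<alpha> * real (f n) + real d')" using A(2)[of "f n"] by (simp add: d'_def)
      finally show ?thesis .
    qed
  qed
  then show ?thesis by blast
qed

end

section \<open>From hypergraphs to extraction\<close>

text \<open>The digit of \<open>w\<close> at place \<open>j\<close> in base \<open>b\<close>. Digits
  let one number stand for a whole system of tuples, so that systems can be searched for.\<close>

definition digit :: "nat \<Rightarrow> nat \<Rightarrow> nat \<Rightarrow> nat" where
  "digit b w j = w div b ^ j mod b"

lemma exists_digits:
  assumes "\<And>j. j < J \<Longrightarrow> \<psi> j < b"
  shows "\<exists>w<b ^ J. \<forall>j<J. digit b w j = \<psi> j"
  using assms
proof (induction J)
  case 0
  then show ?case by simp
next
  case (Suc J)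
  then obtain w where w: "w < b ^ J" "\<forall>j<J. digit b w j = \<psi> j" by force
  have \<psi>: "\<psi> J < b" using Suc.prems by simp
  define w' where "w' = \<psi> J * b ^ J + w"
  have "w' < Suc (\<psi> J) * b ^ J" using w(1) by (simp add: w'_def)
  also have "\<dots> \<le> b * b ^ J" using \<psi> by (intro mult_right_mono) auto
  finally have "w' < b ^ Suc J" by simp
  moreover have "digit b w' j = \<psi> j" if "j < Suc J" for j
  proof (cases "j = J")
    case True
    have "b ^ J \<noteq> 0" using w(1) by linarith
    from div_mult_self3[OF this, of "\<psi> J" w] have "w' div b ^ J = \<psi> J"
      using w(1) by (simp only: w'_def div_less add_0_right)
    then show ?thesis using True \<psi> by (simp add: digit_def)
  next
    case False
    then have j: "j < J" using that by simp
    define i where "i = J - Suc j"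
    have J: "b ^ J = b ^ j * (b * b ^ i)" using j by (simp add: i_def flip: power_Suc power_add)
    have w': "w' = w + b * (\<psi> J * b ^ i) * b ^ j" by (simp add: w'_def J)
    have "b ^ j \<noteq> 0" using \<psi> by simp
    from div_mult_self1[OF this, of w "b * (\<psi> J * b ^ i)"]
    have "w' div b ^ j = b * (\<psi> J * b ^ i) + w div b ^ j" by (simp only: w')
    then have "digit b w' j = digit b w j" by (simp add: digit_def)
    then show ?thesis using w(2) j by simp
  qed
  ultimately show ?case by blast
qed

lemma computable_digit:
  assumes "computable_nat b" "computable_nat w" "computable_nat j"
  shows "computable_nat (\<lambda>x. digit (b x) (w x) (j x))"
  unfolding digit_def by (intro computable_rules assms)

context optimal_function
begin

text \<open>The extractors look up the vertices of an edge in the first suitable system. If all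
  vertices were simple, the edge would be one of fewer than \<open>2 ^ (A (f n) + D)\<close> edges,
  and its place in an enumeration of them would contradict its complexity.\<close>

lemma EXT_code_of_sparse_tuples:
  fixes k d :: nat and f A B :: "nat \<Rightarrow> nat"
  assumes k: "0 < k" and \<alpha>: "0 < \<alpha>" "\<alpha> \<le> 1" and f: "computable_nat f" "strict_mono f"
    and A: "computable_nat A" "\<And>m. \<bar>real (A m) - \<alpha> * real m\<bar> \<le> 2"
    and B: "computable_nat B" "\<And>m. \<bar>real (B m) - \<beta> * real m\<bar> \<le> 2" and \<beta>: "0 \<le> \<beta>"
    and sparse: "\<And>n. k \<le> 2 ^ n \<Longrightarrow> \<exists>\<phi>. sparse_tuples k n (f n) (\<beta> * real n) (\<alpha> * real (f n) + real d) \<phi>"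
  shows "EXT_code k \<alpha> \<beta>"
proof -
  define D where "D = d + 2"
  define vertex where "vertex n w x i = digit (2 ^ n) w (x * k + i)" for n w x i
  \<comment> \<open>Sparsity with the integer approximations \<open>A\<close> and \<open>B\<close>,
    hence decidable; \<open>v\<close> runs through the codes of vertex sets. The shifts by
    \<open>2\<close>, here and in \<open>D\<close>, make this a consequence of real sparsity, also
    where \<open>B n - 2\<close> truncates to \<open>0\<close>, as \<open>\<beta> * n\<close> is
    nonnegative.\<close>
  define good where "good n w \<longleftrightarrow> (\<forall>v<2 ^ (2 ^ n). card {y. y < 2 ^ n \<and> y \<in> set_decode v} \<le> 2 ^ (B n - 2) \<longrightarrow>
      card {x. x < 2 ^ f n \<and> (\<forall>i<k. vertex n w x i \<in> set_decode v)} < 2 ^ (A (f n) + D))" for n w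
  have good_ex: "\<exists>w. good n w" if n: "k \<le> 2 ^ n" for n
  proof -
    obtain \<phi> where \<phi>: "sparse_tuples k n (f n) (\<beta> * real n) (\<alpha> * real (f n) + real d) \<phi>"
      using sparse[OF n] by blast
    define \<psi> where "\<psi> j = \<phi> (j div k) (j mod k)" for j
    have "\<psi> j < 2 ^ n" if "j < 2 ^ f n * k" for j
    proof -
      have "j div k < 2 ^ f n" using that by (rule less_mult_imp_div_less)
      then show ?thesis using \<phi> k by (simp add: \<psi>_def sparse_tuples_def)
    qed
    then obtain w where w: "\<forall>j<2 ^ f n * k. digit (2 ^ n) w j = \<psi> j" using exists_digits by metis
    have vertex: "vertex n w x i = \<phi> x i" if "x < 2 ^ f n" "i < k" for x i
    proof -
      have "x * k + i < Suc x * k" using that by simp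
      also have "\<dots> \<le> 2 ^ f n * k" using that by (intro mult_right_mono) auto
      finally show ?thesis using w that by (simp add: vertex_def \<psi>_def)
    qed
    have "good n w" unfolding good_def
    proof (intro allI impI)
      fix v assume card: "card {y. y < 2 ^ n \<and> y \<in> set_decode v} \<le> 2 ^ (B n - 2)"
      define W where "W = {y. y < 2 ^ n \<and> y \<in> set_decode v}"
      have "real (card W) \<le> real (2 ^ (B n - 2))" using card unfolding W_def by (simp only: of_nat_le_iff)
      also have "\<dots> = 2 powr real (B n - 2)" by (simp add: powr_realpow)
      also have "\<dots> \<le> 2 powr (\<beta> * real n)"
      proof -
        have "0 \<le> \<beta> * real n" using \<beta> by simp
        then have "real (B n - 2) \<le> \<beta> * real n" using B(2)[of n] by linarith
        then show ?thesis by simp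
      qed
      finally have "real (card W) \<le> 2 powr (\<beta> * real n)" .
      moreover have "W \<subseteq> {..<2 ^ n}" by (auto simp: W_def)
      ultimately have "real (card (edges_in k (f n) \<phi> W)) < 2 powr (\<alpha> * real (f n) + real d)"
        using \<phi> unfolding sparse_tuples_def by blast
      also have "\<dots> \<le> 2 powr real (A (f n) + D)" using A(2)[of "f n"] by (simp add: D_def)
      also have "\<dots> = real (2 ^ (A (f n) + D))" using powr_realpow[of 2 "A (f n) + D"] by simp
      finally have "card (edges_in k (f n) \<phi> W) < 2 ^ (A (f n) + D)" by (simp only: of_nat_less_iff)
      moreover have "{x. x < 2 ^ f n \<and> (\<forall>i<k. vertex n w x i \<in> set_decode v)} = edges_in k (f n) \<phi> W"
        using vertex \<phi> by (auto simp: edges_in_def W_def sparse_tuples_def)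
      ultimately show "card {x. x < 2 ^ f n \<and> (\<forall>i<k. vertex n w x i \<in> set_decode v)} < 2 ^ (A (f n) + D)"
        by simp
    qed
    then show ?thesis by blast
  qed
  have vertex_comp: "computable_nat (\<lambda>x. vertex (a1 x) (a2 x) (a3 x) (a4 x))"
    if "computable_nat a1" "computable_nat a2" "computable_nat a3" "computable_nat a4" for a1 a2 a3 a4
    unfolding vertex_def by (intro computable_digit computable_rules that)
  have good_dec: "decidable2 (\<lambda>n w. good n w \<or> 2 ^ n < k)"
    unfolding good_def
    by (intro computable_rules vertex_comp computable_compose[OF A(1)] computable_compose[OF B(1)] computable_compose[OF f(1)])
  \<comment> \<open>The second disjunct makes the search total at the small \<open>n\<close> for
    which nothing is assumed.\<close>
  define G where "G n = (LEAST w. good n w \<or> 2 ^ n < k)" for n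
  have G_ex: "\<exists>w. good n w \<or> 2 ^ n < k" for n using good_ex by (meson not_less)
  have G_comp: "computable_nat G" unfolding G_def by (rule computable_Least[OF G_ex good_dec])
  have G: "good n (G n)" if "k \<le> 2 ^ n" for n
    using LeastI_ex[OF G_ex[of n]] that unfolding G_def[symmetric] by simp
  \<comment> \<open>An input reveals only its length \<open>f n\<close>; strict monotonicity of
    \<open>f\<close> lets \<open>N\<close> recover \<open>n\<close> from it.\<close>
  define N where "N m = (LEAST n. m \<le> f n)" for m
  have f_ge: "n \<le> f n" for n using f(2) by (rule strict_mono_imp_increasing)
  have N_comp: "computable_nat N" unfolding N_def
    by (rule computable_Least) (use f_ge in blast, intro computable_rules computable_compose[OF f(1)])
  have N: "N (f n) = n" for n
    unfolding N_def by (rule Least_equality) (use f(2) in \<open>auto simp: strict_mono_less_eq\<close>)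
  define vert where "vert m x i = vertex (N m) (G (N m)) x i" for m x i
  have vert_comp: "computable_nat (\<lambda>x. vert (a1 x) (a2 x) (a3 x))"
    if "computable_nat a1" "computable_nat a2" "computable_nat a3" for a1 a2 a3
    unfolding vert_def
    by (intro vertex_comp computable_compose[OF G_comp] computable_compose[OF N_comp] that)
  have vert_less: "vert (f n) x i < 2 ^ n" for n x i
    by (simp add: vert_def vertex_def digit_def N)
  define \<gamma> where "\<gamma> i x = nth_code (N (code_length x))
      (vert (code_length x) (x - (2 ^ code_length x - 1)) (i - 1))" for i x
  have \<gamma>_comp: "computable_nat (\<gamma> i)" for i
    unfolding \<gamma>_def
    by (intro vert_comp computable_nth_code computable_compose[OF N_comp] computable_code_length computable_rules)
  have \<gamma>: "\<gamma> (Suc i) (nth_code (f n) x) = nth_code n (vert (f n) x i)" if "x < 2 ^ f n" for n x i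
    using that by (simp add: \<gamma>_def code_length_nth_code N) (simp add: nth_code_def)
  obtain T where T: "step_bounded u T" using step_bounded_exists[OF recursive] by blast
  \<comment> \<open>By stage \<open>s\<close>, programs shorter than \<open>B (N m) - 2\<close> have
    been found for all vertices of the edge \<open>x\<close>.\<close>
  define seen where "seen m s x \<longleftrightarrow> x < 2 ^ m \<and>
      (\<forall>i<k. \<exists>p<2 ^ (B (N m) - 2) - 1. T p s = Suc (nth_code (N m) (vert m x i)))" for m s x
  \<comment> \<open>Recording only the first stage at which \<open>x\<close> is seen enumerates every such \<open>x\<close> exactly once.\<close>
  define arrival where "arrival m z \<longleftrightarrow> seen m (pfst z) (psnd z) \<and> (\<forall>s<pfst z. \<not> seen m s (psnd z))" for m z
  have seen_dec: "decidable (\<lambda>x. seen (a1 x) (a2 x) (a3 x))"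
    if "computable_nat a1" "computable_nat a2" "computable_nat a3" for a1 a2 a3
    unfolding seen_def
    by (intro computable_rules vert_comp computable_nth_code computable_compose[OF N_comp]
        computable_compose[OF B(1)] computable2D[OF step_boundedD(1)[OF T]]
        computable_compose[OF that(1)] computable_compose[OF that(2)] computable_compose[OF that(3)] that)
  have seen_ex: "(\<exists>s. seen m s x) \<longleftrightarrow> x < 2 ^ m \<and> (\<forall>i<k. K (nth_code (N m) (vert m x i)) < B (N m) - 2)" for m x
  proof
    assume "\<exists>s. seen m s x"
    then show "x < 2 ^ m \<and> (\<forall>i<k. K (nth_code (N m) (vert m x i)) < B (N m) - 2)"
      unfolding seen_def K_less_iff using step_boundedD(3)[OF T] by meson
  next
    assume x: "x < 2 ^ m \<and> (\<forall>i<k. K (nth_code (N m) (vert m x i)) < B (N m) - 2)"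
    then have "\<forall>i<k. \<exists>p<2 ^ (B (N m) - 2) - 1. \<exists>s. T p s = Suc (nth_code (N m) (vert m x i))"
      unfolding K_less_iff using step_boundedD(3)[OF T] by meson
    then obtain p s where ps: "\<And>i. i < k \<Longrightarrow> p i < 2 ^ (B (N m) - 2) - 1"
      "\<And>i. i < k \<Longrightarrow> T (p i) (s i) = Suc (nth_code (N m) (vert m x i))" by metis
    have "s i \<le> sum s {..<k}" if "i < k" for i using that by (intro member_le_sum) auto
    then have "T (p i) (sum s {..<k}) = Suc (nth_code (N m) (vert m x i))" if "i < k" for i
      using step_boundedD(2)[OF T ps(2)[OF that]] that by blast
    then have "seen m (sum s {..<k}) x" unfolding seen_def using x ps(1) by blast
    then show "\<exists>s. seen m s x" by blast
  qed
  obtain g R where g: "computable_nat g" and R: "\<And>m. \<exists>r\<le>R. m = g (A m) + r"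
    using approx_inverse[OF A \<alpha>] by metis
  \<comment> \<open>At \<open>t = A m + D\<close> this is the arrival set for length
    \<open>m\<close>, given the right \<open>r\<close>.\<close>
  define Q where "Q r (e::nat) t z \<longleftrightarrow> arrival (g (t - D) + r) z" for r e t z
  obtain c where c: "\<And>r e t z. r \<in> {..R} \<Longrightarrow> Q r e t z \<Longrightarrow> finite {z. Q r e t z} \<Longrightarrow>
      card {z. Q r e t z} \<le> 2 ^ t \<Longrightarrow> K (nth_code (g (t - D) + r) (psnd z)) \<le> t + e + c"
  proof (rule K_decidable_family_finite[of "{..R}" Q "\<lambda>r e t z. nth_code (g (t - D) + r) (psnd z)"])
    show "decidable3 (Q r)" for r unfolding decidable3_def Q_def arrival_def
      by (intro seen_dec computable_compose[OF g] computable_rules)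
    show "computable3 (\<lambda>e t z. nth_code (g (t - D) + r) (psnd z))" for r unfolding computable3_def
      by (intro computable_nth_code computable_compose[OF g] computable_rules)
  qed (simp, rule that, blast)
  have K_seen: "K (nth_code (f n) x) \<le> A (f n) + D + c"
    if n: "k \<le> 2 ^ n" and x: "x < 2 ^ f n" "\<And>i. i < k \<Longrightarrow> K (nth_code n (vert (f n) x i)) < B n - 2" for n x
  proof -
    define m where "m = f n"
    have Nm: "N m = n" by (simp add: m_def N)
    \<comment> \<open>The set of simple vertices need not be decidable: \<open>good\<close> bounds
      the edges inside every small vertex set, so \<open>W\<close> enters only the counting.\<close>
    define W where "W = {y. y < 2 ^ n \<and> K (nth_code n y) < B n - 2}"
    have finW: "finite W" by (simp add: W_def)
    have "card (nth_code n ` W) < 2 ^ (B n - 2)" using finW by (intro card_K_less) (auto simp: W_def)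
    moreover have "card (nth_code n ` W) = card W" by (rule card_image) (simp add: inj_on_def nth_code_inj)
    ultimately have cardW: "card W \<le> 2 ^ (B n - 2)" by simp
    define S where "S = {x. x < 2 ^ f n \<and> (\<forall>i<k. vertex n (G n) x i \<in> W)}"
    have enc: "set_encode W < 2 ^ 2 ^ n" by (rule set_encode_less) (auto simp: W_def)
    have dec: "set_decode (set_encode W) = W" using finW by simp
    have "{y. y < 2 ^ n \<and> y \<in> W} = W" by (auto simp: W_def)
    then have "card {y. y < 2 ^ n \<and> y \<in> set_decode (set_encode W)} \<le> 2 ^ (B n - 2)"
      using cardW by (simp only: dec)
    from G[OF n, unfolded good_def, rule_format, OF enc this]
    have cardS: "card S < 2 ^ (A m + D)" by (simp only: dec S_def m_def)
    have S_iff: "(\<exists>s. seen m s y) \<longleftrightarrow> y \<in> S" for y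
      unfolding seen_ex using vert_less[of n y]
      by (auto simp: S_def W_def Nm m_def vert_def N)
    have inj: "inj_on psnd {z. arrival m z}"
    proof (rule inj_onI)
      fix z z' assume z: "z \<in> {z. arrival m z}" "z' \<in> {z. arrival m z}" "psnd z = psnd z'"
      have "\<not> pfst z < pfst z'" "\<not> pfst z' < pfst z"
        using z unfolding arrival_def mem_Collect_eq by metis+
      then have "prod_decode z = prod_decode z'" using z(3) by (intro prod_eqI) simp_all
      then show "z = z'" by simp
    qed
    have sub: "psnd ` {z. arrival m z} \<subseteq> S" using S_iff by (auto simp: arrival_def)
    have finS: "finite S" by (simp add: S_def)
    have fin: "finite {z. arrival m z}" using inj_on_finite[OF inj sub finS] .
    have card: "card {z. arrival m z} \<le> 2 ^ (A m + D)"
      using card_inj_on_le[OF inj sub finS] cardS by simp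
    obtain r where r: "r \<le> R" "m = g (A m) + r" using R by blast
    have "x \<in> S"
      using x vert_less[of n x] by (auto simp: S_def W_def vert_def N)
    then obtain s where s: "seen m s x" using S_iff by blast
    define s0 where "s0 = (LEAST s. seen m s x)"
    have "seen m s0 x" unfolding s0_def using s by (rule LeastI)
    moreover have "\<not> seen m s x" if "s < s0" for s using that unfolding s0_def by (rule not_less_Least)
    ultimately have arr: "arrival m (prod_encode (s0, x))" by (simp add: arrival_def)
    have Q_iff: "Q r 0 (A m + D) z \<longleftrightarrow> arrival m z" for z unfolding Q_def using r(2) by simp
    have "K (nth_code (g (A m + D - D) + r) (psnd (prod_encode (s0, x)))) \<le> A m + D + 0 + c"
      using r(1) arr fin card by (intro c) (simp_all add: Q_iff)
    then show ?thesis using r(2) by (simp add: m_def)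
  qed
  obtain c0 where c0: "\<And>y. K y \<le> code_length y + c0" using K_le_length by blast
  \<comment> \<open>The part \<open>D + c + 5\<close> outweighs the bound of \<open>K_seen\<close>
    and the errors of \<open>A\<close> and \<open>B\<close>. For \<open>2 ^ n < k\<close> one has
    \<open>f n < f k\<close>, so \<open>c0 + f k\<close> pushes the complexity threshold above every
    string of length \<open>f n\<close>.\<close>
  define dE where "dE = D + c + 5 + c0 + f k"
  have "(\<forall>i\<in>{1..k}. code_length (\<gamma> i x) = n) \<and> (real (K x) \<ge> \<alpha> * real (f n) + real dE \<longrightarrow>
      (\<exists>i\<in>{1..k}. real (K (\<gamma> i x)) \<ge> \<beta> * real n - real dE))" if len: "code_length x = f n" for n x
  proof (intro conjI impI ballI)
    fix i show "code_length (\<gamma> i x) = n"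
      unfolding \<gamma>_def len N using vert_less by (simp add: code_length_nth_code)
  next
    assume large: "real (K x) \<ge> \<alpha> * real (f n) + real dE"
    have \<alpha>f: "0 \<le> \<alpha> * real (f n)" using \<alpha> by simp
    show "\<exists>i\<in>{1..k}. real (K (\<gamma> i x)) \<ge> \<beta> * real n - real dE"
    proof (rule ccontr)
      assume "\<not> ?thesis"
      then have small: "\<And>i. i \<in> {1..k} \<Longrightarrow> real (K (\<gamma> i x)) < \<beta> * real n - real dE" by force
      obtain v where v: "v < 2 ^ f n" "x = nth_code (f n) v" using code_length_cases[OF len] by blast
      show False
      proof (cases "k \<le> 2 ^ n")
        case True
        have "K (nth_code n (vert (f n) v i)) < B n - 2" if i: "i < k" for i
        proof -
          have "real (K (nth_code n (vert (f n) v i))) < \<beta> * real n - real dE"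
            using small[of "Suc i"] i \<gamma>[OF v(1)] by (simp add: v(2))
          then have "real (K (nth_code n (vert (f n) v i))) + 2 < real (B n)"
            using B(2)[of n] unfolding dE_def by simp
          then show ?thesis by linarith
        qed
        from K_seen[OF True v(1) this] have "real (K x) \<le> real (A (f n)) + real D + real c"
          unfolding v(2) by linarith
        then show False using large A(2)[of "f n"] unfolding dE_def by simp
      next
        case False
        then have "n < k" using less_exp[of n] by linarith
        then have "f n < f k" using f(2) by (simp add: strict_mono_less)
        then have "K x < dE" using c0[of x] len by (simp add: dE_def)
        then show False using large \<alpha>f by linarith
      qed
    qed
  qed
  moreover have "inj f" using f(2) by (rule strict_mono_imp_inj_on)
  ultimately show ?thesis unfolding EXT_code_def using f(1) \<gamma>_comp by blast
qed

end

section \<open>The equivalence\<close>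

lemma (in optimal_function) EXT_code_trivial:
  assumes "0 < k" "\<beta> \<le> \<alpha>"
  shows "EXT_code k \<alpha> \<beta>"
  unfolding EXT_code_def
proof (intro exI conjI allI impI ballI)
  show "computable_nat (\<lambda>x. x)" "computable_nat (\<lambda>x. x)" by (rule computable_id)+
  show "inj (\<lambda>x::nat. x)" by simp
  fix n x assume "code_length x = n" "real (K x) \<ge> \<alpha> * real n + real 0"
  moreover have "\<beta> * real n \<le> \<alpha> * real n" using assms by (intro mult_right_mono) auto
  ultimately show "\<exists>i\<in>{1..k}. real (K x) \<ge> \<beta> * real n - real 0"
    using assms(1) by (intro bexI[of _ 1]) auto
qed auto

text \<open>Edge \<open>e\<close> is vertex \<open>e\<close> repeated \<open>k\<close> times, so a
  vertex set spans as many edges as it has elements; the \<open>1\<close> is there for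
  strictness.\<close>

lemma sparse_tuples_trivial:
  assumes "0 < k" "\<beta> \<le> \<alpha>"
  shows "sparse_tuples k n n (\<beta> * real n) (\<alpha> * real n + real 1) (\<lambda>e i. e)"
  unfolding sparse_tuples_def
proof (intro conjI allI impI)
  fix W :: "nat set" assume W: "W \<subseteq> {..<2 ^ n}" "real (card W) \<le> 2 powr (\<beta> * real n)"
  have "edges_in k n (\<lambda>e i. e) W \<subseteq> W" using assms(1) by (auto simp: edges_in_def)
  then have "real (card (edges_in k n (\<lambda>e i. e) W)) \<le> real (card W)"
    using W(1) by (simp add: card_mono finite_subset)
  also note W(2)
  also have "2 powr (\<beta> * real n) < 2 powr (\<alpha> * real n + real 1)"
    using mult_right_mono[OF assms(2), of "real n"] by simp
  finally show "real (card (edges_in k n (\<lambda>e i. e) W)) < 2 powr (\<alpha> * real n + real 1)" .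
qed

lemma sparse_tuples_mono:
  assumes "sparse_tuples k n m x y \<phi>" "x' \<le> x"
  shows "sparse_tuples k n m x' y \<phi>"
proof -
  have "2 powr x' \<le> 2 powr x" using assms(2) by simp
  then show ?thesis using assms(1) unfolding sparse_tuples_def by (meson order_trans)
qed

lemma ratio_bound_id:
  assumes "0 \<le> \<alpha>" "0 \<le> \<beta>" "\<beta> \<le> \<alpha>"
  shows "ratio_bound \<alpha> \<beta> (\<lambda>n. n)"
proof (cases "\<alpha> = 0")
  case True
  then show ?thesis using assms ratio_bound_0_0 by simp
next
  case False
  then have "\<beta> / \<alpha> * real n - 0 \<le> real n" for n
    using assms by (simp add: field_simps mult_right_mono)
  then show ?thesis using False assms ratio_bound_pos[of \<alpha> \<beta>] by (metis less_eq_real_def)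
qed

lemma (in optimal_function) EXT_code_imp_sparse_tuples:
  assumes "EXT_code k \<alpha> \<beta>" "0 < k" "0 \<le> \<alpha>" "\<alpha> < \<beta>" "\<beta> \<le> 1" "computable_real \<alpha>" "computable_real \<beta>"
  shows "\<exists>(d::nat) f. computable_nat f \<and> ratio_bound \<alpha> \<beta> f \<and>
    (\<forall>n. \<exists>\<phi>. sparse_tuples k n (f n) (\<beta> * real n - real d) (\<alpha> * real (f n) + real d) \<phi>)"
proof -
  obtain f \<gamma> d where f: "computable_nat f" "inj f" and \<gamma>: "\<And>i. i \<in> {1..k} \<Longrightarrow> computable_nat (\<gamma> i)"
    and len: "\<And>n x i. code_length x = f n \<Longrightarrow> i \<in> {1..k} \<Longrightarrow> code_length (\<gamma> i x) = n"
    and ext: "\<And>n x. code_length x = f n \<Longrightarrow> real (K x) \<ge> \<alpha> * real (f n) + real d \<Longrightarrow>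
      \<exists>i\<in>{1..k}. real (K (\<gamma> i x)) \<ge> \<beta> * real n - real d"
    using assms(1) unfolding EXT_code_def by blast
  obtain A where A: "computable_nat A" "\<And>m. \<bar>real (A m) - \<alpha> * real m\<bar> \<le> 2"
    using computable_real_approx[OF assms(6,3)] by blast
  have \<beta>: "0 < \<beta>" using assms by linarith
  obtain B where B: "computable_nat B" "\<And>m. \<bar>real (B m) - \<beta> * real m\<bar> \<le> 2"
    using computable_real_approx[OF assms(7)] \<beta> by (metis less_imp_le)
  have "\<alpha> < 1" using assms by linarith
  with assms \<beta> have "ratio_bound \<alpha> \<beta> f" by (intro EXT_ratio_bound[OF f \<gamma> ext _ _ _ _ A])
  moreover have "\<exists>d'::nat. \<forall>n. \<exists>\<phi>. sparse_tuples k n (f n) (\<beta> * real n - real d') (\<alpha> * real (f n) + real d') \<phi>"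
    using assms \<beta> by (intro EXT_sparse_tuples[OF f(1) _ \<gamma> len ext _ _ A B])
  ultimately show ?thesis using f(1) by blast
qed

lemma (in optimal_function) sparse_tuples_imp_EXT_code:
  assumes f: "ratio_bound \<alpha> \<beta> f"
    and sparse: "\<And>n. k \<le> 2 ^ n \<Longrightarrow> \<exists>\<phi>. sparse_tuples k n (f n) (\<beta> * real n) (\<alpha> * real (f n) + real d) \<phi>"
    and k: "0 < k" and ab: "0 \<le> \<alpha>" "\<alpha> < \<beta>" "\<beta> \<le> 1" and comp: "computable_real \<alpha>" "computable_real \<beta>"
  shows "EXT_code k \<alpha> \<beta>"
proof -
  have \<beta>: "0 < \<beta>" and \<alpha>1: "\<alpha> < 1" using ab by linarith+
  have "\<alpha> \<noteq> 0" using f not_ratio_bound_0[OF \<beta>] by blast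
  then have \<alpha>: "0 < \<alpha>" using ab by simp
  obtain A where A: "computable_nat A" "\<And>m. \<bar>real (A m) - \<alpha> * real m\<bar> \<le> 2"
    using computable_real_approx[OF comp(1) ab(1)] by blast
  obtain B where B: "computable_nat B" "\<And>m. \<bar>real (B m) - \<beta> * real m\<bar> \<le> 2"
    using computable_real_approx[OF comp(2)] \<beta> by (metis less_imp_le)
  obtain F c where F: "computable_nat F" "strict_mono F"
    and c: "\<And>n. \<bar>real (F n) - \<beta> / \<alpha> * real n\<bar> \<le> real c"
    using computable_linear_strict_mono[OF comp \<alpha> ab(2,3)] by blast
  obtain d' :: nat where d': "\<And>n. k \<le> 2 ^ n \<Longrightarrow>
      \<exists>\<phi>. sparse_tuples k n (F n) (\<beta> * real n) (\<alpha> * real (F n) + real d') \<phi>"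
  proof (cases "(1 - \<alpha>) * (\<beta> / \<alpha>) < real k * (1 - \<beta>)")
    case True
    then show thesis using sparse_tuples_random[OF \<beta> ab(3) \<alpha> \<alpha>1 True c] that by blast
  next
    case False
    then have large: "real k * (1 - \<beta>) \<le> (1 - \<alpha>) * (\<beta> / \<alpha>)" by simp
    obtain c1 :: nat where c1: "\<And>n. k \<le> 2 ^ n \<Longrightarrow> real (f n) \<le> \<beta> / \<alpha> * real n + real c1"
      using sparse_tuples_size_bound[OF k \<beta> ab(3) \<alpha> \<alpha>1 large sparse] by blast
    obtain c2 where c2: "\<And>n. \<beta> / \<alpha> * real n - c2 \<le> real (f n)"
      using f ratio_bound_pos[OF \<alpha>] by blast
    \<comment> \<open>The sum of the deviations of \<open>F\<close> and \<open>f\<close> from the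
      line bounds their distance in both directions.\<close>
    define b where "b = c + c1 + nat \<lceil>c2\<rceil>"
    have "\<exists>\<phi>. sparse_tuples k n (F n) (\<beta> * real n) (\<alpha> * real (F n) + real (d + 2 * b)) \<phi>"
      if n: "k \<le> 2 ^ n" for n
    proof -
      obtain \<phi> where \<phi>: "sparse_tuples k n (f n) (\<beta> * real n) (\<alpha> * real (f n) + real d) \<phi>"
        using sparse[OF n] by blast
      have "real (f n) \<le> real (F n) + real b"
        using c1[OF n] c[of n] unfolding b_def by linarith
      moreover have "real (F n) \<le> real (f n) + real b"
        using c2[of n] c[of n] unfolding b_def by linarith
      ultimately have "F n \<le> f n + b" "f n \<le> F n + b" by linarith+
      then show ?thesis using sparse_tuples_resize[OF \<phi>] \<alpha> \<alpha>1 by (meson less_imp_le)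
    qed
    then show thesis by (rule that)
  qed
  show ?thesis
    by (rule EXT_code_of_sparse_tuples[OF k \<alpha> _ F A B _ d']) (use \<alpha>1 \<beta> in simp_all)
qed

theorem theorem18:
  fixes U :: "bool list \<Rightarrow> bool list option" and k :: nat and \<alpha> \<beta> :: real
  assumes "optimal_machine U"
    and "k \<ge> 2"
    and "\<alpha> \<in> {0..1}" and "\<beta> \<in> {0..1}"
    and "computable_real \<alpha>" and "computable_real \<beta>"
  shows
    "((\<alpha>, \<beta>) \<in> EXT U k \<longleftrightarrow>
      (\<exists>(d::nat) (f :: nat \<Rightarrow> nat). computable_nat f \<and> ratio_bound \<alpha> \<beta> f \<and>
        (\<forall>n. k \<le> 2 ^ n \<longrightarrow>
          (\<exists>(V :: nat set) (E :: nat set) (inc :: nat \<Rightarrow> nat set).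
            k_hypergraph k V E inc \<and> card V = 2 ^ n \<and> card E = 2 ^ f n \<and>
            (\<forall>W \<subseteq> V. real (card W) \<le> 2 powr (\<beta> * real n - real d) \<longrightarrow>
              real (edges_within E inc W) < 2 powr (\<alpha> * real (f n) + real d))))))
    \<and>
     ((\<alpha>, \<beta>) \<in> EXT U k \<longleftrightarrow>
      (\<exists>(d::nat) (f :: nat \<Rightarrow> nat). computable_nat f \<and> ratio_bound \<alpha> \<beta> f \<and>
        (\<forall>n. k \<le> 2 ^ n \<longrightarrow>
          (\<exists>(V :: nat set) (E :: nat set) (inc :: nat \<Rightarrow> nat set).
            k_hypergraph k V E inc \<and> card V = 2 ^ n \<and> card E = 2 ^ f n \<and>
            (\<forall>W \<subseteq> V. real (card W) \<le> 2 powr (\<beta> * real n) \<longrightarrow>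
              real (edges_within E inc W) < 2 powr (\<alpha> * real (f n) + real d))))))"
proof -
  have k: "0 < k" and ab: "0 \<le> \<alpha>" "0 \<le> \<beta>" "\<beta> \<le> 1" using assms(2-4) by auto
  have tuples: "(\<exists>(V :: nat set) (E :: nat set) (inc :: nat \<Rightarrow> nat set).
            k_hypergraph k V E inc \<and> card V = 2 ^ n \<and> card E = 2 ^ m \<and>
            (\<forall>W \<subseteq> V. real (card W) \<le> 2 powr x \<longrightarrow> real (edges_within E inc W) < 2 powr y))
      \<longleftrightarrow> (\<exists>\<phi>. sparse_tuples k n m x y \<phi>)"
    (is "?G \<longleftrightarrow> ?T") if "k \<le> 2 ^ n" for n m x y
  proof
    assume ?G
    then obtain V E :: "nat set" and inc where "k_hypergraph k V E inc" "card V = 2 ^ n" "card E = 2 ^ m"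
      "\<And>W. W \<subseteq> V \<Longrightarrow> real (card W) \<le> 2 powr x \<Longrightarrow> real (edges_within E inc W) < 2 powr y" by auto
    then show ?T by (rule sparse_tuples_of_hypergraph)
  next
    assume ?T
    then obtain \<phi> where "sparse_tuples k n m x y \<phi>" ..
    then show ?G using that by (rule hypergraph_of_sparse_tuples)
  qed
  obtain u where u: "optimal_function u" "\<And>p. u (str_code p) = map_option str_code (U p)"
    using optimal_machine_function[OF assms(1)] by blast
  interpret optimal_function u by (rule u(1))
  \<comment> \<open>One predicate for both conditions: \<open>x\<close> is \<open>real\<close> for
    (b) and the zero function for (c).\<close>
  let ?P = "\<lambda>x. \<exists>(d::nat) f. computable_nat f \<and> ratio_bound \<alpha> \<beta> f \<and>
    (\<forall>n. k \<le> 2 ^ n \<longrightarrow> (\<exists>\<phi>. sparse_tuples k n (f n) (\<beta> * real n - x d) (\<alpha> * real (f n) + real d) \<phi>))"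
  have main: "(EXT_code k \<alpha> \<beta> \<longleftrightarrow> ?P real) \<and> (EXT_code k \<alpha> \<beta> \<longleftrightarrow> ?P (\<lambda>_. 0))"
  proof (cases "\<beta> \<le> \<alpha>")
    case True
    have "sparse_tuples k n n (\<beta> * real n - real 1) (\<alpha> * real n + real 1) (\<lambda>e i. e)"
      "sparse_tuples k n n (\<beta> * real n - 0) (\<alpha> * real n + real 1) (\<lambda>e i. e)" for n
      by (rule sparse_tuples_mono[OF sparse_tuples_trivial[OF k True]], simp)+
    then have "?P real" "?P (\<lambda>_. 0)" using ratio_bound_id[OF ab(1,2) True] computable_id by blast+
    then show ?thesis using EXT_code_trivial[OF k True] by blast
  next
    case False
    then have less: "\<alpha> < \<beta>" by simp
    have "?P real" if "EXT_code k \<alpha> \<beta>"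
      using EXT_code_imp_sparse_tuples[OF that k ab(1) less ab(3) assms(5,6)] by blast
    moreover have "?P (\<lambda>_. 0)" if "?P real"
    proof -
      obtain d :: nat and f where f: "computable_nat f" "ratio_bound \<alpha> \<beta> f"
        and \<phi>: "\<And>n. k \<le> 2 ^ n \<Longrightarrow>
          \<exists>\<phi>. sparse_tuples k n (f n) (\<beta> * real n - real d) (\<alpha> * real (f n) + real d) \<phi>"
        using \<open>?P real\<close> by blast
      obtain d' :: nat where "\<And>n \<phi>. sparse_tuples k n (f n) (\<beta> * real n - real d) (\<alpha> * real (f n) + real d) \<phi> \<Longrightarrow>
          sparse_tuples k n (f n) (\<beta> * real n - 0) (\<alpha> * real (f n) + real d') \<phi>"
        using sparse_tuples_shift[OF k _ ab(1), of \<beta> f d] less ab by (metis diff_zero le_less_trans)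
      then show ?thesis using f \<phi> by blast
    qed
    moreover have "EXT_code k \<alpha> \<beta>" if zero: "?P (\<lambda>_. 0)"
    proof -
      obtain d :: nat and f where "ratio_bound \<alpha> \<beta> f" "\<And>n. k \<le> 2 ^ n \<Longrightarrow>
          \<exists>\<phi>. sparse_tuples k n (f n) (\<beta> * real n) (\<alpha> * real (f n) + real d) \<phi>"
        using zero by auto
      then show ?thesis using k ab(1) less ab(3) assms(5,6) by (rule sparse_tuples_imp_EXT_code)
    qed
    ultimately show ?thesis by blast
  qed
  show ?thesis
    unfolding EXT_iff_code[OF u assms(3,4)]
    by (simp only: tuples cong: imp_cong) (rule main[unfolded diff_zero])
qed

end
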